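(* Let $u\in U_c(\mathcal H)$ and let $\beta:[0,1]\to U_c(\mathcal H)$ be a geodesic such that $d_\infty(u,\beta(s))<\frac{\pi}{2}$ for all $s\in[0,1]$. Then the function $g(s)=d_\infty(u,\beta(s))$, $s\in[0,1]$, is convex.
   Context: $\mathcal H$ is a Hilbert space, $\mathcal K(\mathcal H)$ is the space of compact operators on $\mathcal H$, $\mathcal K(\mathcal H)_{ah}=\{x\in\mathcal K(\mathcal H): x^*=-x\}$, and $U_c(\mathcal H)=\{u: u \text{ unitary on } \mathcal H,\ u-1\in\mathcal K(\mathcal H)\}$ is the unitary Fredholm group, with Lie algebra $\mathcal K(\mathcal H)_{ah}$. A curve is smooth if it is $C^1$ (for the operator norm) with non-vanishing derivative. The length of a piecewise smooth curve $\gamma:[a,b]\to U_c(\mathcal H)$ is $L(\gamma)=\int_a^b\|\dot\gamma(t)\|\,dt$, with $\|\cdot\|$ the operator norm, and $d_\infty(u,v)$ is the infimum of the lengths of the piecewise smooth curves in $U_c(\mathcal H)$ joining $u$ to $v$. A geodesic of $U_c(\mathcal H)$ is a curve of the form $\beta(s)=we^{sz}$ with $w\in U_c(\mathcal H)$ and $z\in\mathcal K(\mathcal H)_{ah}$. *)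

theory Defs
  imports "HOL-Analysis.Analysis"
begin

section \<open>Complex Hilbert spaces\<close>

text \<open>
  A complex Hilbert space is a complete real inner product space with a compatible complex scalar
  multiplication and a sesquilinear form whose real part is the real inner product, so that the
  norm is the one induced by \<^term>\<open>cinner\<close>.  The form is conjugate-linear in its first argument.
  No separability or dimension assumption is made.
\<close>

class complex_hilbert_space = real_inner + complete_space +
  fixes scaleC :: "complex \<Rightarrow> 'a \<Rightarrow> 'a" (infixr \<open>*\<^sub>C\<close> 75)
    and cinner :: "'a \<Rightarrow> 'a \<Rightarrow> complex"
  assumes scaleC_add_right: "c *\<^sub>C (x + y) = c *\<^sub>C x + c *\<^sub>C y"
    and scaleC_add_left: "(c + d) *\<^sub>C x = c *\<^sub>C x + d *\<^sub>C x"
    and scaleC_scaleC: "c *\<^sub>C d *\<^sub>C x = (c * d) *\<^sub>C x"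
    and scaleC_of_real: "complex_of_real r *\<^sub>C x = r *\<^sub>R x"
    and cinner_commute: "cinner x y = cnj (cinner y x)"
    and cinner_add_left: "cinner (x + y) z = cinner x z + cinner y z"
    and cinner_scaleC_left: "cinner (c *\<^sub>C x) y = cnj c * cinner x y"
    and Re_cinner: "Re (cinner x y) = inner x y"

instantiation complex :: complex_hilbert_space
begin

definition scaleC_complex :: "complex \<Rightarrow> complex \<Rightarrow> complex"
  where "scaleC_complex c x = c * x"

definition cinner_complex :: "complex \<Rightarrow> complex \<Rightarrow> complex"
  where "cinner_complex x y = cnj x * y"

instance
  by standard
    (auto simp: scaleC_complex_def cinner_complex_def algebra_simps scaleR_conv_of_real
      inner_complex_def)

end

lemma cinner_self: "cinner x x = complex_of_real ((norm x)\<^sup>2)"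
proof (rule complex_eqI)
  show "Re (cinner x x) = Re (complex_of_real ((norm x)\<^sup>2))"
    by (simp add: Re_cinner dot_square_norm)
  show "Im (cinner x x) = Im (complex_of_real ((norm x)\<^sup>2))"
    using arg_cong[OF cinner_commute[of x x], of Im] by simp
qed

lemma cinner_scaleC_right: "cinner x (c *\<^sub>C y) = c * cinner x y"
  by (metis cinner_commute cinner_scaleC_left complex_cnj_cnj complex_cnj_mult)

lemma inner_left_eqI:
  assumes "\<And>z. inner z x = inner z y"
  shows "x = (y::'a::real_inner)"
  by (metis assms inner_commute vector_eq_ldot)

lemma Im_cinner: "Im (cinner x y) = inner (\<i> *\<^sub>C x) y"
  by (simp add: Re_cinner[symmetric] cinner_scaleC_left)

section \<open>Operators\<close>

text \<open>
  Bounded operators are represented as real-linear bounded maps \<^typ>\<open>'a \<Rightarrow>\<^sub>L 'a\<close>; the norm of this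
  type is the operator norm.  Complex linearity is stated separately.
\<close>

definition complex_linear :: "('a::complex_hilbert_space \<Rightarrow>\<^sub>L 'a) \<Rightarrow> bool"
  where "complex_linear A \<longleftrightarrow> (\<forall>c x. blinfun_apply A (c *\<^sub>C x) = c *\<^sub>C blinfun_apply A x)"

definition is_cadjoint :: "('a::complex_hilbert_space \<Rightarrow>\<^sub>L 'a) \<Rightarrow> ('a \<Rightarrow>\<^sub>L 'a) \<Rightarrow> bool"
  where "is_cadjoint A B \<longleftrightarrow>
    (\<forall>x y. cinner (blinfun_apply A x) y = cinner x (blinfun_apply B y))"

definition cadjoint :: "('a::complex_hilbert_space \<Rightarrow>\<^sub>L 'a) \<Rightarrow> 'a \<Rightarrow>\<^sub>L 'a"
  where "cadjoint A = (THE B. is_cadjoint A B)"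

definition compact_operators :: "('a::complex_hilbert_space \<Rightarrow>\<^sub>L 'a) set"
  where "compact_operators =
    {A. complex_linear A \<and> compact (closure (blinfun_apply A ` cball 0 1))}"

definition compact_antihermitian :: "('a::complex_hilbert_space \<Rightarrow>\<^sub>L 'a) set"
  where "compact_antihermitian = {A \<in> compact_operators. cadjoint A = - A}"

definition unitary_operators :: "('a::complex_hilbert_space \<Rightarrow>\<^sub>L 'a) set"
  where "unitary_operators =
    {U. complex_linear U \<and> U o\<^sub>L cadjoint U = id_blinfun \<and> cadjoint U o\<^sub>L U = id_blinfun}"

definition fredholm_unitary_group :: "('a::complex_hilbert_space \<Rightarrow>\<^sub>L 'a) set"
  where "fredholm_unitary_group = {U \<in> unitary_operators. U - id_blinfun \<in> compact_operators}"

text \<open>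
  The library's \<^const>\<open>exp\<close> requires a normed algebra type with \<open>norm 1 = 1\<close>, hence the explicit
  power series; the iterated composition is the \<open>n\<close>-th power of \<open>A\<close>.
\<close>

definition blinfun_exp :: "('a::real_normed_vector \<Rightarrow>\<^sub>L 'a) \<Rightarrow> 'a \<Rightarrow>\<^sub>L 'a"
  where "blinfun_exp A = (\<Sum>n. (1 / fact n) *\<^sub>R (((o\<^sub>L) A) ^^ n) id_blinfun)"

section \<open>Well-definedness of the adjoint and the exponential\<close>

lemma riesz_representation:
  fixes f :: "'a::{real_inner, complete_space} \<Rightarrow> real"
  assumes f: "bounded_linear f"
  shows "\<exists>v. \<forall>x. f x = inner v x"
proof -
  interpret f: bounded_linear f by fact
  define J where "J x = (norm x)\<^sup>2 - 2 * f x" for x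
  obtain K where K: "\<And>x. norm (f x) \<le> norm x * K"
    using f.bounded by blast
  have J_ge: "J x \<ge> - K\<^sup>2" for x
  proof -
    have "f x \<le> norm x * K" using K[of x] by simp
    moreover have "0 \<le> (norm x - K)\<^sup>2" by simp
    ultimately show ?thesis by (simp add: J_def power2_diff)
  qed
  have bdd: "bdd_below (range J)"
    using J_ge by (auto intro!: bdd_belowI)
  define m where "m = Inf (range J)"
  have m_le: "m \<le> J x" for x
    unfolding m_def by (rule cInf_lower) (use bdd in auto)
  have "\<exists>x. J x < m + 1 / real (Suc n)" for n
    using cInf_lessD[of "range J" "m + 1 / real (Suc n)"] unfolding m_def by auto
  then obtain X where X: "\<And>n. J (X n) < m + 1 / real (Suc n)" by metis
  have par: "(norm (x - y))\<^sup>2 \<le> 2 * (J x - m) + 2 * (J y - m)" for x y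
  proof -
    have "(norm (x - y))\<^sup>2 = 2 * J x + 2 * J y - 4 * J ((1/2) *\<^sub>R (x + y))"
      by (simp add: J_def power2_norm_eq_inner f.add f.scaleR inner_add_left inner_add_right
          inner_diff_left inner_diff_right inner_commute algebra_simps)
    then show ?thesis using m_le[of "(1/2) *\<^sub>R (x + y)"] by simp
  qed
  have "Cauchy X"
  proof (rule metric_CauchyI)
    fix e :: real assume e: "e > 0"
    then obtain N where N: "inverse (real (Suc N)) < e\<^sup>2 / 4"
      using reals_Archimedean[of "e\<^sup>2 / 4"] by auto
    have "dist (X i) (X j) < e" if "i \<ge> N" "j \<ge> N" for i j
    proof -
      have "J (X k) - m < e\<^sup>2 / 4" if "k \<ge> N" for k
      proof -
        have "1 / real (Suc k) \<le> 1 / real (Suc N)" using that by (simp add: field_simps)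
        then show ?thesis using X[of k] N by (simp add: inverse_eq_divide)
      qed
      from this[OF that(1)] this[OF that(2)] have "(norm (X i - X j))\<^sup>2 < e\<^sup>2"
        using par[of "X i" "X j"] by simp
      then show ?thesis using e by (simp add: dist_norm power2_less_imp_less)
    qed
    then show "\<exists>M. \<forall>i\<ge>M. \<forall>j\<ge>M. dist (X i) (X j) < e" by blast
  qed
  then obtain v where v: "X \<longlonglongrightarrow> v"
    using Cauchy_convergent convergent_def by blast
  have "(\<lambda>n. J (X n)) \<longlonglongrightarrow> J v"
    unfolding J_def by (intro tendsto_intros v f.tendsto)
  moreover have "(\<lambda>n. m + 1 / real (Suc n)) \<longlonglongrightarrow> m + 0"
    by (intro tendsto_intros LIMSEQ_Suc[OF lim_1_over_n])
  ultimately have "J v \<le> m + 0"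
    by (rule LIMSEQ_le) (use X less_imp_le in blast)
  then have Jv: "J v \<le> J x" for x using m_le[of x] by simp
  have "f h = inner v h" for h
  proof (cases "h = 0")
    case True then show ?thesis by simp
  next
    case False
    define a where "a = f h - inner v h"
    define t where "t = a / (norm h)\<^sup>2"
    have h: "(norm h)\<^sup>2 > 0" using False by simp
    have "J (v + t *\<^sub>R h) = J v - 2 * t * a + t\<^sup>2 * (norm h)\<^sup>2"
      unfolding J_def a_def power2_norm_eq_inner
      by (simp add: f.add f.scaleR inner_add_left inner_add_right
          inner_commute power2_eq_square algebra_simps)
    also have "\<dots> = J v - a\<^sup>2 / (norm h)\<^sup>2"
      using False by (simp add: t_def power2_eq_square field_simps)
    finally have "a\<^sup>2 / (norm h)\<^sup>2 \<le> 0" using Jv[of "v + t *\<^sub>R h"] by simp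
    then have "a\<^sup>2 \<le> 0" using h by (simp add: divide_le_0_iff)
    then show ?thesis by (simp add: a_def)
  qed
  then show ?thesis by blast
qed

lemma is_cadjoint_unique: "is_cadjoint A B \<Longrightarrow> is_cadjoint A C \<Longrightarrow> B = C"
  by (rule blinfun_eqI, rule inner_left_eqI) (metis is_cadjoint_def Re_cinner)

lemma is_cadjoint_exists:
  fixes A :: "'a::complex_hilbert_space \<Rightarrow>\<^sub>L 'a"
  assumes A: "complex_linear A"
  shows "\<exists>B. is_cadjoint A B"
proof -
  have "\<exists>v. \<forall>x. inner (blinfun_apply A x) y = inner v x" for y
    by (rule riesz_representation)
      (intro bounded_linear_intros)
  then obtain b where "\<And>x y. inner (blinfun_apply A x) y = inner (b y) x" by metis
  then have b: "inner (blinfun_apply A x) y = inner x (b y)" for x y by (metis inner_commute)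
  have "bounded_linear b"
  proof (rule bounded_linear_intro[where K = "norm A"])
    show "b (x + y) = b x + b y" for x y
      by (rule inner_left_eqI) (simp add: inner_add_right flip: b)
    show "b (r *\<^sub>R x) = r *\<^sub>R b x" for r x
      by (rule inner_left_eqI) (simp flip: b)
    show "norm (b x) \<le> norm x * norm A" for x
    proof (cases "b x = 0")
      case False
      have "norm (b x) * norm (b x) = inner (blinfun_apply A (b x)) x"
        by (simp add: b power2_norm_eq_inner flip: power2_eq_square)
      also have "\<dots> \<le> norm (blinfun_apply A (b x)) * norm x" by (rule norm_cauchy_schwarz)
      also have "\<dots> \<le> norm A * norm (b x) * norm x"
        by (intro mult_right_mono norm_blinfun) auto
      finally show ?thesis using False by (simp add: mult.commute mult.left_commute)
    qed auto
  qed
  then have "blinfun_apply (Blinfun b) = b" by (rule bounded_linear_Blinfun_apply)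
  moreover have "cinner (blinfun_apply A x) y = cinner x (b y)" for x y
  proof (rule complex_eqI)
    show "Re (cinner (blinfun_apply A x) y) = Re (cinner x (b y))"
      by (simp add: Re_cinner b)
    show "Im (cinner (blinfun_apply A x) y) = Im (cinner x (b y))"
      using A by (simp add: Im_cinner complex_linear_def flip: b)
  qed
  ultimately show ?thesis by (metis is_cadjoint_def)
qed

lemma is_cadjoint_cadjoint: "complex_linear A \<Longrightarrow> is_cadjoint A (cadjoint A)"
  unfolding cadjoint_def by (rule theI') (use is_cadjoint_exists is_cadjoint_unique in blast)

lemma norm_blinfun_power_le:
  fixes A :: "'a::real_normed_vector \<Rightarrow>\<^sub>L 'a"
  shows "norm ((((o\<^sub>L) A) ^^ n) id_blinfun) \<le> norm A ^ n"
proof (induction n)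
  case 0
  show ?case by (simp add: norm_blinfun_id_le)
next
  case (Suc n)
  show ?case
    using norm_blinfun_compose[of A "(((o\<^sub>L) A) ^^ n) id_blinfun"]
      mult_left_mono[OF Suc norm_ge_zero[of A]] by simp
qed

lemma summable_blinfun_exp:
  fixes A :: "'a::banach \<Rightarrow>\<^sub>L 'a"
  shows "summable (\<lambda>n. (1 / fact n) *\<^sub>R (((o\<^sub>L) A) ^^ n) id_blinfun)"
proof (rule summable_comparison_test')
  show "summable (\<lambda>n. norm A ^ n /\<^sub>R fact n)" by (rule summable_exp_generic)
  show "norm ((1 / fact n) *\<^sub>R (((o\<^sub>L) A) ^^ n) id_blinfun) \<le> norm A ^ n /\<^sub>R fact n" for n
    using norm_blinfun_power_le[where A=A and n=n] by (simp add: divide_simps)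
qed

section \<open>Curves, rectifiable distance, geodesics\<close>

definition smooth_curve_on :: "real \<Rightarrow> real \<Rightarrow> (real \<Rightarrow> 'b::real_normed_vector) \<Rightarrow> bool"
  where "smooth_curve_on a b \<gamma> \<longleftrightarrow>
    (\<exists>\<gamma>'. (\<forall>t\<in>{a..b}. (\<gamma> has_vector_derivative \<gamma>' t) (at t within {a..b}) \<and> \<gamma>' t \<noteq> 0) \<and>
          continuous_on {a..b} \<gamma>')"

text \<open>
  The pieces are closed intervals, with one-sided derivatives at the break points; continuity of
  the whole curve follows.  The case \<open>n = 0\<close> is the one-point curve on \<open>[a,a]\<close>; it only
  ensures that distances of a point to itself vanish on the zero space as well.
\<close>

definition piecewise_smooth_curve_on :: "real \<Rightarrow> real \<Rightarrow> (real \<Rightarrow> 'b::real_normed_vector) \<Rightarrow> bool"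
  where "piecewise_smooth_curve_on a b \<gamma> \<longleftrightarrow>
    (\<exists>(n::nat) p. p 0 = a \<and> p n = b \<and>
      (\<forall>i<n. p i < p (Suc i) \<and> smooth_curve_on (p i) (p (Suc i)) \<gamma>))"

text \<open>The derivative may fail to exist at the finitely many break points, a null set.\<close>

definition curve_length :: "real \<Rightarrow> real \<Rightarrow> (real \<Rightarrow> 'b::real_normed_vector) \<Rightarrow> real"
  where "curve_length a b \<gamma> =
    integral {a..b} (\<lambda>t. norm (vector_derivative \<gamma> (at t within {a..b})))"

text \<open>
  The infimum is taken in \<^typ>\<open>ereal\<close>, so that it is meaningful (\<open>\<infinity>\<close> if no curve joins the
  points) without relying on the connectedness of the group.
\<close>

definition d_inf ::
  "('a::complex_hilbert_space \<Rightarrow>\<^sub>L 'a) \<Rightarrow> ('a \<Rightarrow>\<^sub>L 'a) \<Rightarrow> ereal"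
  where "d_inf u v = Inf {ereal (curve_length a b \<gamma>) | a b \<gamma>.
    piecewise_smooth_curve_on a b \<gamma> \<and> \<gamma> ` {a..b} \<subseteq> fredholm_unitary_group \<and>
    \<gamma> a = u \<and> \<gamma> b = v}"

definition is_geodesic_on :: "real set \<Rightarrow> (real \<Rightarrow> 'a::complex_hilbert_space \<Rightarrow>\<^sub>L 'a) \<Rightarrow> bool"
  where "is_geodesic_on S \<beta> \<longleftrightarrow>
    (\<exists>w\<in>fredholm_unitary_group. \<exists>z\<in>compact_antihermitian.
      \<forall>s\<in>S. \<beta> s = w o\<^sub>L blinfun_exp (s *\<^sub>R z))"

end

theory Submission
  imports Defs
begin

text \<open>
Put \<open>m(s)\<close> for the infimum of \<open>inner (u x) (\<beta> s x)\<close> over unit vectors \<open>x\<close>, and \<open>g(s)\<close> for the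
distance from \<open>u\<close> to \<open>\<beta> s\<close>.  The proof identifies the distance with an angle,
\<open>cos (g s) = m(s)\<close>, and then differentiates this infimum along the geodesic.

\<^bold>\<open>The distance is an angle.\<close>  A curve \<open>\<gamma>\<close> of unitaries moves a unit vector \<open>x\<close> along a curve
\<open>\<gamma>(t) x\<close> of the unit sphere whose speed is at most \<open>norm (\<gamma>'(t))\<close>; hence every curve from \<open>u\<close> to
\<open>v\<close> is at least as long as the angle between \<open>u x\<close> and \<open>v x\<close> (\<open>d_inf_ge_angle\<close>).  Conversely, if
all these angles are at most \<open>\<theta> < \<pi>/2\<close>, a curve of length at most \<open>\<theta>\<close> can be written down without
taking a logarithm: let \<open>q = u\<^sup>* v\<close>, take its Cayley transform \<open>k = (q - 1) (q + 1)\<^sup>-\<^sup>1\<close>, which is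
compact, skew and of norm at most \<open>tan (\<theta>/2) < 1\<close>, and follow \<open>u (1 + t k) (1 - t k)\<^sup>-\<^sup>1\<close> for \<open>t\<close>
from \<open>0\<close> to \<open>1\<close>.  Its speed integrates to at most \<open>2 arctan (tan (\<theta>/2)) = \<theta>\<close>
(\<open>d_inf_le_angle\<close>).

\<^bold>\<open>Second order behaviour.\<close>  Compactness of \<open>v - u\<close> makes a largest angle \<open>\<theta> > 0\<close> attained at an
eigenvector: \<open>u\<^sup>* v \<xi> = e\<^sup>\<plusminus>\<^sup>i\<^sup>\<theta> \<xi>\<close> (\<open>extremal_angle_eigenvector\<close>).  Suppose this happens for
\<open>v = \<beta> s\<^sub>0\<close>.  The function \<open>h(s) = inner (u \<xi>) (\<beta> s \<xi>)\<close> lies above \<open>cos (g s)\<close> and agrees with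
it at \<open>s\<^sub>0\<close>.  Writing \<open>cinner \<xi> (z \<xi>) = i a\<close>, the eigenvector equation gives
\<open>h'(s\<^sub>0) = \<minusplus> a sin \<theta>\<close> and \<open>h''(s\<^sub>0) = - cos \<theta> \<parallel>z \<xi>\<parallel>\<^sup>2\<close>, and \<open>a\<^sup>2 \<le> \<parallel>z \<xi>\<parallel>\<^sup>2\<close>.  Since
\<open>cos \<theta> \<ge> 0\<close>, this says that \<open>arccos (h s)\<close>, a lower support function of \<open>g\<close> at \<open>s\<^sub>0\<close>, has
nonnegative second derivative there.

\<^bold>\<open>From support functions to convexity.\<close>  A continuous function that is not convex is touched from
above, at an interior point, by a parabola with negative leading coefficient
(\<open>convex_on_if_not_touched_by_concave_parabola\<close>).  At such a point the cosine of the parabola lies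
below \<open>h\<close> and touches it, which the derivatives above forbid.
\<close>

text \<open>
Complex Hilbert spaces are Banach spaces; the Neumann and exponential series need this instance.
\<close>

instance complex_hilbert_space \<subseteq> banach
  by standard

section \<open>A touching criterion for convexity\<close>

text \<open>
If \<open>g\<close> rises above one of its chords, subtract from \<open>g\<close> the chord and a small multiple of
\<open>(s - x) (y - s)\<close>.  The result vanishes at the ends \<open>x\<close> and \<open>y\<close> and is positive somewhere
in between, and at a point where it is maximal the chord plus the parabola, suitably raised,
touches \<open>g\<close> from above.
\<close>

lemma convex_on_if_not_touched_by_concave_parabola:
  fixes g :: "real \<Rightarrow> real"
  assumes cont: "continuous_on {a..b} g"
    and not_touched: "\<And>s0 p e d. \<lbrakk>e > 0; d > 0;
      \<And>s. \<bar>s - s0\<bar> < d \<Longrightarrow> s \<in> {a..b} \<and> g s \<le> g s0 + p * (s - s0) - e * (s - s0)\<^sup>2\<rbrakk> \<Longrightarrow> False"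
  shows "convex_on {a..b} g"
proof (rule ccontr)
  assume "\<not> convex_on {a..b} g"
  have "\<exists>t x y. 0 < t \<and> t < 1 \<and> x \<in> {a..b} \<and> y \<in> {a..b} \<and> x < y \<and>
      (1 - t) * g x + t * g y < g ((1 - t) * x + t * y)" (is ?chord)
  proof (rule ccontr)
    assume no_chord: "\<not> ?chord"
    have "convex_on {a..b} g"
    proof (rule convex_on_linorderI)
      fix t x y :: real
      assume "0 < t" "t < 1" "x \<in> {a..b}" "y \<in> {a..b}" "x < y"
      with no_chord have "g ((1 - t) * x + t * y) \<le> (1 - t) * g x + t * g y"
        by (meson not_less)
      then show "g ((1 - t) *\<^sub>R x + t *\<^sub>R y) \<le> (1 - t) * g x + t * g y" by simp
    qed simp
    with \<open>\<not> convex_on {a..b} g\<close> show False by blast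
  qed
  then obtain t x y where t: "0 < t" "t < 1" and xy: "x \<in> {a..b}" "y \<in> {a..b}" "x < y"
    and above: "(1 - t) * g x + t * g y < g ((1 - t) * x + t * y)"
    by blast
  define m where "m = (1 - t) * x + t * y"
  have m_diff: "m - x = t * (y - x)" "y - m = (1 - t) * (y - x)"
    by (simp_all add: m_def algebra_simps)
  have m: "x < m" "m < y"
    using m_diff t xy(3) by (smt (verit) mult_pos_pos)+
  define k where "k = (g y - g x) / (y - x)"
  have k: "k * (y - x) = g y - g x" using xy(3) by (simp add: k_def)
  define l where "l s = g x + k * (s - x)" for s
  have "l m = g x + t * (k * (y - x))"
    by (simp add: l_def m_diff)
  then have "l m = (1 - t) * g x + t * g y"
    by (simp only: k) (simp add: algebra_simps)
  with above have gap: "g m - l m > 0" by (simp add: m_def)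
  \<comment> \<open>this choice makes the parabola eat up exactly half of the gap at \<open>m\<close>\<close>
  define e where "e = (g m - l m) / (2 * ((m - x) * (y - m)))"
  have e: "e > 0" using gap m by (simp add: e_def)
  define \<psi> where "\<psi> s = g s - l s - e * ((s - x) * (y - s))" for s
  have "e * ((m - x) * (y - m)) = (g m - l m) / 2"
    using m by (simp add: e_def)
  then have "\<psi> m = (g m - l m) / 2"
    by (simp add: \<psi>_def)
  then have \<psi>_m: "\<psi> m > 0" using gap by simp
  have \<psi>_ends: "\<psi> x = 0" "\<psi> y = 0"
    by (simp_all add: \<psi>_def l_def k)
  have "continuous_on {x..y} g"
    using cont by (rule continuous_on_subset) (use xy in auto)
  then have "continuous_on {x..y} \<psi>"
    unfolding \<psi>_def l_def by (intro continuous_intros)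
  then obtain s0 where s0: "s0 \<in> {x..y}" and max: "\<And>s. s \<in> {x..y} \<Longrightarrow> \<psi> s \<le> \<psi> s0"
    using continuous_attains_sup[of "{x..y}" \<psi>] xy(3) by auto
  have "\<psi> s0 > 0" using max[of m] \<psi>_m m by simp
  then have s0_int: "x < s0" "s0 < y"
    using s0 \<psi>_ends by (auto simp: less_le)
  \<comment> \<open>the slope at \<open>s0\<close> of the chord plus the parabola\<close>
  define p where "p = k + e * (x + y - 2 * s0)"
  define d where "d = min (s0 - x) (y - s0)"
  have "s \<in> {a..b} \<and> g s \<le> g s0 + p * (s - s0) - e * (s - s0)\<^sup>2" if s: "\<bar>s - s0\<bar> < d" for s
  proof
    show "s \<in> {a..b}" using s xy by (auto simp: d_def)
    have "l s + e * ((s - x) * (y - s)) - l s0 - e * ((s0 - x) * (y - s0))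
        = p * (s - s0) - e * (s - s0)\<^sup>2"
      by (simp add: l_def p_def power2_eq_square algebra_simps)
    moreover have "\<psi> s \<le> \<psi> s0" using s by (intro max) (auto simp: d_def)
    ultimately show "g s \<le> g s0 + p * (s - s0) - e * (s - s0)\<^sup>2"
      by (simp add: \<psi>_def)
  qed
  then show False
    using not_touched[OF e, of d s0 p] s0_int by (auto simp: d_def)
qed

lemma not_local_min_if_second_derivative_neg:
  fixes D D1 :: "real \<Rightarrow> real"
  assumes D: "\<And>s. (D has_real_derivative D1 s) (at s)"
    and D1: "(D1 has_real_derivative D2) (at s0)"
    and zero: "D1 s0 = 0" and neg: "D2 < 0"
    and "d > 0"
  obtains s where "\<bar>s - s0\<bar> < d" "D s < D s0"
proof -
  obtain r where r: "r > 0" "\<And>h. 0 < h \<Longrightarrow> h < r \<Longrightarrow> D1 (s0 + h) < 0"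
    using DERIV_neg_dec_right[OF D1 neg] zero by auto
  define h where "h = min r d / 2"
  have h: "0 < h" "h < r" "h < d" using r(1) \<open>d > 0\<close> by (auto simp: h_def)
  have "D (s0 + h) < D s0"
  proof (rule DERIV_neg_imp_decreasing_open[where f = D and a = s0 and b = "s0 + h"])
    show "s0 < s0 + h" using h by simp
    show "\<exists>y. DERIV D x :> y \<and> y < 0" if "s0 < x" "x < s0 + h" for x
      using D[of x] r(2)[of "x - s0"] that h by auto
    show "continuous_on {s0..s0 + h} D"
      by (rule DERIV_continuous_on) (rule has_field_derivative_at_within[OF D])
  qed
  then show ?thesis using that[of "s0 + h"] h by simp
qed

section \<open>Lower bounds for lengths of curves\<close>

lemma curve_length_nonneg: "curve_length a b \<gamma> \<ge> 0"
  unfolding curve_length_def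
  by (metis integral_nonneg norm_ge_zero not_integrable_integral order_refl)

text \<open>
A length is bounded below by the increment of any real function that is controlled on each smooth
piece.  At the break points the integrand of the length is an arbitrary value, which does not
affect the integral.
\<close>

lemma curve_length_ge_increment:
  fixes \<gamma> :: "real \<Rightarrow> 'b::real_normed_vector" and A :: "real \<Rightarrow> real"
  assumes curve: "piecewise_smooth_curve_on a b \<gamma>"
    and piece: "\<And>c d \<gamma>'. \<lbrakk>a \<le> c; c < d; d \<le> b; continuous_on {c..d} \<gamma>';
        \<And>t. t \<in> {c..d} \<Longrightarrow> (\<gamma> has_vector_derivative \<gamma>' t) (at t within {c..d})\<rbrakk>
      \<Longrightarrow> A d - A c \<le> integral {c..d} (\<lambda>t. norm (\<gamma>' t))"
  shows "A b - A a \<le> curve_length a b \<gamma>"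
proof -
  obtain n :: nat and p where p0: "p 0 = a" and pn: "p n = b"
    and p: "\<And>i. i < n \<Longrightarrow> p i < p (Suc i) \<and> smooth_curve_on (p i) (p (Suc i)) \<gamma>"
    using curve unfolding piecewise_smooth_curve_on_def by auto
  have mono: "p i \<le> p j" if "i \<le> j" "j \<le> n" for i j
    using that
  proof (induction j rule: dec_induct)
    case (step m)
    then show ?case using p[of m] by simp
  qed simp
  define v where "v t = norm (vector_derivative \<gamma> (at t within {a..b}))" for t
  have "\<exists>I. (v has_integral I) {a..p k} \<and> A (p k) - A a \<le> I" if "k \<le> n" for k
    using that
  proof (induction k)
    case 0
    show ?case by (simp add: p0 exI[of _ 0] has_integral_refl)
  next
    case (Suc k)
    then obtain I where I: "(v has_integral I) {a..p k}" "A (p k) - A a \<le> I" by auto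
    let ?c = "p k" and ?d = "p (Suc k)"
    have cd: "?c < ?d" "a \<le> ?c" "?d \<le> b"
      using p[of k] mono[of 0 k] mono[of "Suc k" n] Suc.prems p0 pn by auto
    obtain \<gamma>' where \<gamma>': "\<And>t. t \<in> {?c..?d} \<Longrightarrow>
        (\<gamma> has_vector_derivative \<gamma>' t) (at t within {?c..?d})"
      and cont: "continuous_on {?c..?d} \<gamma>'"
      using p[of k] Suc.prems unfolding smooth_curve_on_def Suc_le_eq by metis
    have "v t = norm (\<gamma>' t)" if t: "t \<in> {?c..?d} - {?c, ?d}" for t
    proof -
      have "(\<gamma> has_vector_derivative \<gamma>' t) (at t)"
        using \<gamma>'[of t] t at_within_Icc_at[of ?c t ?d] by simp
      then have "vector_derivative \<gamma> (at t within {a..b}) = \<gamma>' t"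
        by (rule vector_derivative_at_within_ivl) (use t cd in auto)
      then show ?thesis by (simp add: v_def)
    qed
    moreover have "((\<lambda>t. norm (\<gamma>' t)) has_integral integral {?c..?d} (\<lambda>t. norm (\<gamma>' t))) {?c..?d}"
      by (intro integrable_integral integrable_continuous_real continuous_intros cont)
    ultimately have "(v has_integral integral {?c..?d} (\<lambda>t. norm (\<gamma>' t))) {?c..?d}"
      by (intro has_integral_spike_finite[of "{?c, ?d}" _ v]) auto
    from has_integral_combine[OF _ _ I(1) this]
    have "(v has_integral I + integral {?c..?d} (\<lambda>t. norm (\<gamma>' t))) {a..?d}"
      using cd by simp
    moreover have "A ?d - A ?c \<le> integral {?c..?d} (\<lambda>t. norm (\<gamma>' t))"
      by (rule piece) (use cd cont \<gamma>' in auto)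
    ultimately show ?case using I(2)
      by (intro exI[of _ "I + integral {?c..?d} (\<lambda>t. norm (\<gamma>' t))"]) auto
  qed
  from this[of n] obtain I where "(v has_integral I) {a..b}" "A b - A a \<le> I"
    using pn by auto
  then show ?thesis
    unfolding curve_length_def v_def[symmetric] by (simp add: integral_unique)
qed

text \<open>
The angle between \<open>e\<close> and a point moving on the unit sphere changes no faster than the point moves.
The angle fails to be differentiable where it is \<open>0\<close> or \<open>\<pi>\<close>; shrinking the cosine by a
factor \<open>\<rho> < 1\<close> removes these singularities and does not increase the speed, because
\<open>\<rho>\<^sup>2 (1 - f\<^sup>2) \<le> 1 - \<rho>\<^sup>2 f\<^sup>2\<close>.
\<close>

lemma arccos_increment_le_arclength:
  fixes p :: "real \<Rightarrow> 'a::real_inner"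
  assumes "c < d"
    and p': "\<And>t. t \<in> {c..d} \<Longrightarrow> (p has_vector_derivative p' t) (at t within {c..d})"
    and sphere: "\<And>t. t \<in> {c..d} \<Longrightarrow> norm (p t) = 1"
    and speed: "\<And>t. t \<in> {c..d} \<Longrightarrow> norm (p' t) \<le> v t"
    and v: "continuous_on {c..d} v"
    and e: "norm e = 1"
    and \<rho>: "0 \<le> \<rho>" "\<rho> < 1"
  shows "arccos (\<rho> * inner e (p d)) - arccos (\<rho> * inner e (p c)) \<le> integral {c..d} v"
proof -
  define f where "f t = inner e (p t)" for t
  define f' where "f' t = inner e (p' t)" for t
  have f_bound: "\<bar>f t\<bar> \<le> 1" if "t \<in> {c..d}" for t
    using Cauchy_Schwarz_ineq2[of e "p t"] e sphere[OF that] by (simp add: f_def)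
  have lt: "\<bar>\<rho> * f t\<bar> < 1" if "t \<in> {c..d}" for t
  proof -
    have "\<rho> * \<bar>f t\<bar> \<le> \<rho> * 1" by (rule mult_left_mono) (use f_bound[OF that] \<rho> in auto)
    then show ?thesis using \<rho> by (simp add: abs_mult)
  qed
  have f_der: "(f has_real_derivative f' t) (at t within {c..d})" if "t \<in> {c..d}" for t
    unfolding f_def f'_def has_real_derivative_iff_has_vector_derivative
    by (rule bounded_linear.has_vector_derivative[OF bounded_linear_inner_right p'[OF that]])
  have orth: "inner (p t) (p' t) = 0" if t: "t \<in> {c..d}" for t
  proof -
    have "((\<lambda>t. inner (p t) (p t)) has_vector_derivative
        inner (p t) (p' t) + inner (p' t) (p t)) (at t within {c..d})"
      by (rule bounded_bilinear.has_vector_derivative[OF bounded_bilinear_inner p'[OF t] p'[OF t]])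
    moreover have "((\<lambda>t. inner (p t) (p t)) has_vector_derivative 0) (at t within {c..d})"
    proof (rule has_vector_derivative_transform[OF t])
      show "((\<lambda>_. 1) has_vector_derivative 0) (at t within {c..d})" for t :: real
        by (rule has_vector_derivative_const)
    qed (use sphere in \<open>simp add: dot_square_norm\<close>)
    ultimately have "inner (p t) (p' t) + inner (p' t) (p t) = 0"
      using vector_derivative_unique_within_closed_interval[of c d t] t \<open>c < d\<close>
      unfolding cbox_interval by blast
    then show ?thesis by (simp add: inner_commute)
  qed
  \<comment> \<open>the velocity is tangent to the sphere, so only the part of \<open>e\<close> orthogonal to \<open>p t\<close> matters\<close>
  have f'_bound: "\<bar>f' t\<bar> \<le> sqrt (1 - (f t)\<^sup>2) * v t" if t: "t \<in> {c..d}" for t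
  proof -
    have "f' t = inner (e - f t *\<^sub>R p t) (p' t)"
      using orth[OF t] by (simp add: f'_def inner_diff_left)
    then have "\<bar>f' t\<bar> \<le> norm (e - f t *\<^sub>R p t) * norm (p' t)"
      by (simp add: Cauchy_Schwarz_ineq2)
    moreover have "(norm (e - f t *\<^sub>R p t))\<^sup>2 = 1 - (f t)\<^sup>2"
    proof -
      have "inner e e = 1" "inner (p t) (p t) = 1"
        using e sphere[OF t] by (simp_all add: dot_square_norm)
      then show ?thesis
        unfolding power2_norm_eq_inner
        by (simp add: inner_diff_left inner_diff_right f_def inner_commute
            power2_eq_square algebra_simps)
    qed
    then have "norm (e - f t *\<^sub>R p t) = sqrt (1 - (f t)\<^sup>2)"
      by (metis norm_ge_zero real_sqrt_unique)
    ultimately have "\<bar>f' t\<bar> \<le> sqrt (1 - (f t)\<^sup>2) * norm (p' t)" by simp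
    also have "\<dots> \<le> sqrt (1 - (f t)\<^sup>2) * v t"
      using f_bound[OF t] by (intro mult_left_mono speed t) (simp add: abs_square_le_1)
    finally show ?thesis .
  qed
  define A' where "A' t = inverse (- sqrt (1 - (\<rho> * f t)\<^sup>2)) * (\<rho> * f' t)" for t
  have A: "((\<lambda>t. arccos (\<rho> * f t)) has_vector_derivative A' t) (at t within {c..d})"
    if t: "t \<in> {c..d}" for t
  proof -
    have "((\<lambda>t. \<rho> * f t) has_real_derivative \<rho> * f' t) (at t within {c..d})"
      by (intro DERIV_cmult f_der t)
    moreover have "(arccos has_real_derivative inverse (- sqrt (1 - (\<rho> * f t)\<^sup>2))) (at (\<rho> * f t))"
      using lt[OF t] by (intro DERIV_arccos) (auto simp: abs_if split: if_splits)
    ultimately have "((\<lambda>t. arccos (\<rho> * f t)) has_real_derivative A' t) (at t within {c..d})"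
      unfolding A'_def by (rule DERIV_chain2[rotated])
    then show ?thesis by (simp add: has_real_derivative_iff_has_vector_derivative)
  qed
  have "A' t \<le> v t" if t: "t \<in> {c..d}" for t
  proof -
    let ?r = "sqrt (1 - (\<rho> * f t)\<^sup>2)"
    have sq: "(\<rho> * f t)\<^sup>2 < 1" using lt[OF t] by (simp add: abs_square_less_1)
    then have r: "?r > 0" by simp
    have v0: "v t \<ge> 0" using speed[OF t] norm_ge_zero[of "p' t"] by linarith
    have "\<rho> * sqrt (1 - (f t)\<^sup>2) = sqrt (\<rho>\<^sup>2 * (1 - (f t)\<^sup>2))"
      using \<rho> by (simp add: real_sqrt_mult)
    also have "\<dots> \<le> ?r"
      using \<rho> by (intro real_sqrt_le_mono) (simp add: power_mult_distrib algebra_simps power_le_one)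
    finally have *: "\<rho> * sqrt (1 - (f t)\<^sup>2) \<le> ?r" .
    have "\<bar>\<rho> * f' t\<bar> \<le> \<rho> * (sqrt (1 - (f t)\<^sup>2) * v t)"
      using f'_bound[OF t] \<rho> by (simp add: abs_mult mult_left_mono)
    also have "\<dots> \<le> ?r * v t"
      using mult_right_mono[OF * v0] by (simp add: mult.assoc)
    finally have "- (\<rho> * f' t) \<le> ?r * v t" by linarith
    then have "- (\<rho> * f' t) / ?r \<le> v t"
      unfolding pos_divide_le_eq[OF r] by (simp add: mult.commute)
    then show ?thesis by (simp add: A'_def field_simps)
  qed
  moreover have "(A' has_integral arccos (\<rho> * f d) - arccos (\<rho> * f c)) {c..d}"
    by (rule fundamental_theorem_of_calculus) (use A \<open>c < d\<close> in auto)
  moreover have "(v has_integral integral {c..d} v) {c..d}"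
    by (intro integrable_integral integrable_continuous_real v)
  ultimately show ?thesis
    unfolding f_def by (blast intro: has_integral_le)
qed

section \<open>Operators on a complex Hilbert space\<close>

lemma inner_scaleC_left: "inner (c *\<^sub>C x) y = Re (cnj c * cinner x y)"
  by (simp add: Re_cinner[symmetric] cinner_scaleC_left)

lemma norm_scaleC: "norm (c *\<^sub>C x) = cmod c * norm (x::'a::complex_hilbert_space)"
proof -
  have "complex_of_real ((norm (c *\<^sub>C x))\<^sup>2) = cnj c * (c * complex_of_real ((norm x)\<^sup>2))"
    by (simp only: cinner_self[symmetric] cinner_scaleC_left cinner_scaleC_right
        mult.left_commute)
  also have "\<dots> = complex_of_real ((cmod c * norm x)\<^sup>2)"
    using complex_norm_square[of c] by (simp add: power_mult_distrib mult.commute mult.left_commute)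
  finally have "(norm (c *\<^sub>C x))\<^sup>2 = (cmod c * norm x)\<^sup>2"
    by (simp only: of_real_eq_iff)
  then show ?thesis by (rule power2_eq_imp_eq) auto
qed

lemma scaleC_minus_right: "c *\<^sub>C (- x) = - (c *\<^sub>C (x::'a::complex_hilbert_space))"
proof -
  have "c *\<^sub>C (0::'a) = 0" using scaleC_add_right[of c 0 "0::'a"] by simp
  then have "c *\<^sub>C x + c *\<^sub>C (- x) = 0" using scaleC_add_right[of c x "- x"] by simp
  then show ?thesis by (simp add: add_eq_0_iff)
qed

lemma scaleC_diff_right: "c *\<^sub>C (x - y) = c *\<^sub>C x - c *\<^sub>C (y::'a::complex_hilbert_space)"
  using scaleC_add_right[of c x "- y"] by (simp add: scaleC_minus_right)

lemma scaleC_scaleR: "c *\<^sub>C (r *\<^sub>R x) = r *\<^sub>R (c *\<^sub>C (x::'a::complex_hilbert_space))"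
  by (simp only: scaleC_of_real[symmetric] scaleC_scaleC mult.commute)

lemma complex_linear_simps:
  "complex_linear id_blinfun"
  "complex_linear A \<Longrightarrow> complex_linear B \<Longrightarrow> complex_linear (A + B)"
  "complex_linear A \<Longrightarrow> complex_linear B \<Longrightarrow> complex_linear (A - B)"
  "complex_linear A \<Longrightarrow> complex_linear B \<Longrightarrow> complex_linear (A o\<^sub>L B)"
  "complex_linear A \<Longrightarrow> complex_linear (r *\<^sub>R A)"
  by (simp_all add: complex_linear_def blinfun.add_left blinfun.diff_left blinfun.scaleR_left
      scaleC_add_right scaleC_diff_right scaleC_scaleR)

text \<open>
Inverses obtained from series or adjoints inherit complex linearity, so that it never has to be
checked on the series.
\<close>

lemma complex_linear_inverse:
  assumes A: "complex_linear A" and AB: "A o\<^sub>L B = id_blinfun" and BA: "B o\<^sub>L A = id_blinfun"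
  shows "complex_linear B"
  unfolding complex_linear_def
proof (intro allI)
  fix c x
  have "A (B x) = x" for x using arg_cong[OF AB, of "\<lambda>F. blinfun_apply F x"] by simp
  moreover have "B (A x) = x" for x using arg_cong[OF BA, of "\<lambda>F. blinfun_apply F x"] by simp
  moreover have "A (c *\<^sub>C B x) = c *\<^sub>C A (B x)"
    using A unfolding complex_linear_def by blast
  ultimately show "B (c *\<^sub>C x) = c *\<^sub>C B x" by metis
qed

lemma compact_operatorsI:
  assumes "complex_linear A" "compact K" "blinfun_apply A ` cball 0 1 \<subseteq> K"
  shows "A \<in> compact_operators"
proof -
  have "closure (blinfun_apply A ` cball 0 1) \<subseteq> K"
    by (intro closure_minimal assms compact_imp_closed)
  then have "compact (closure (blinfun_apply A ` cball 0 1))"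
    by (metis assms(2) closed_closure compact_Int_closed inf.absorb_iff2)
  with assms(1) show ?thesis by (simp add: compact_operators_def)
qed

lemma compact_operatorsD:
  assumes "A \<in> compact_operators"
  shows "complex_linear A" "compact (closure (blinfun_apply A ` cball 0 1))"
  using assms by (auto simp: compact_operators_def)

lemma compact_operators_add:
  assumes A: "A \<in> compact_operators" and B: "B \<in> compact_operators"
  shows "A + B \<in> compact_operators"
proof (rule compact_operatorsI)
  show "complex_linear (A + B)" by (intro complex_linear_simps compact_operatorsD A B)
  show "compact {x + y |x y. x \<in> closure (blinfun_apply A ` cball 0 1) \<and>
      y \<in> closure (blinfun_apply B ` cball 0 1)}"
    by (intro compact_sums compact_operatorsD A B)
  show "blinfun_apply (A + B) ` cball 0 1 \<subseteq> {x + y |x y. x \<in> closure (blinfun_apply A ` cball 0 1) \<and>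
      y \<in> closure (blinfun_apply B ` cball 0 1)}"
  proof (rule image_subsetI)
    fix x :: 'a assume "x \<in> cball 0 1"
    then have "A x \<in> closure (blinfun_apply A ` cball 0 1)"
      "B x \<in> closure (blinfun_apply B ` cball 0 1)"
      by (auto intro!: subsetD[OF closure_subset])
    then show "(A + B) x \<in> {x + y |x y. x \<in> closure (blinfun_apply A ` cball 0 1) \<and>
        y \<in> closure (blinfun_apply B ` cball 0 1)}"
      unfolding blinfun.add_left by blast
  qed
qed

lemma compact_operators_compose_left:
  assumes A: "A \<in> compact_operators" and B: "complex_linear B"
  shows "B o\<^sub>L A \<in> compact_operators"
proof (rule compact_operatorsI)
  show "complex_linear (B o\<^sub>L A)" by (intro complex_linear_simps compact_operatorsD A B)
  show "compact (blinfun_apply B ` closure (blinfun_apply A ` cball 0 1))"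
    by (intro compact_continuous_image compact_operatorsD A)
      (intro linear_continuous_on blinfun.bounded_linear_right)
  show "blinfun_apply (B o\<^sub>L A) ` cball 0 1 \<subseteq> blinfun_apply B ` closure (blinfun_apply A ` cball 0 1)"
    using closure_subset by fastforce
qed

lemma compact_operators_scaleR:
  assumes "A \<in> compact_operators"
  shows "r *\<^sub>R A \<in> compact_operators"
proof -
  have "r *\<^sub>R A = (r *\<^sub>R id_blinfun) o\<^sub>L A"
    by (rule blinfun_eqI) (simp add: blinfun.scaleR_left)
  then show ?thesis
    using compact_operators_compose_left[OF assms] complex_linear_simps(1,5) by metis
qed

lemma compact_operators_diff:
  assumes A: "A \<in> compact_operators" and B: "B \<in> compact_operators"
  shows "A - B \<in> compact_operators"
proof -
  have "A - B = A + (-1) *\<^sub>R B" by (simp only: scaleR_minus1_left diff_conv_add_uminus)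
  then show ?thesis by (metis compact_operators_add compact_operators_scaleR A B)
qed

lemma compact_operators_compose_right:
  assumes A: "A \<in> compact_operators" and B: "complex_linear B"
  shows "A o\<^sub>L B \<in> compact_operators"
proof (rule compact_operatorsI)
  define r where "r = norm B + 1"
  have r: "r > 0" "norm B \<le> r" unfolding r_def by (rule add_nonneg_pos, rule norm_ge_zero, rule zero_less_one) linarith
  show "complex_linear (A o\<^sub>L B)" by (intro complex_linear_simps compact_operatorsD A B)
  show "compact ((*\<^sub>R) r ` closure (blinfun_apply A ` cball 0 1))"
    by (intro compact_scaling compact_operatorsD A)
  have "A (B x) \<in> (*\<^sub>R) r ` closure (blinfun_apply A ` cball 0 1)" if x: "norm x \<le> 1" for x
  proof
    have "norm (B x) \<le> norm B * norm x" by (rule norm_blinfun)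
    also have "\<dots> \<le> r" using mult_mono[OF r(2) x] r(1) by simp
    finally have "norm ((1 / r) *\<^sub>R B x) \<le> 1" using r by (simp add: field_simps)
    then have "A ((1 / r) *\<^sub>R B x) \<in> blinfun_apply A ` cball 0 1" by auto
    then show "A ((1 / r) *\<^sub>R B x) \<in> closure (blinfun_apply A ` cball 0 1)"
      by (rule subsetD[OF closure_subset])
    show "A (B x) = r *\<^sub>R A ((1 / r) *\<^sub>R B x)" using r(1) by (simp add: blinfun.scaleR_right)
  qed
  then show "blinfun_apply (A o\<^sub>L B) ` cball 0 1 \<subseteq> (*\<^sub>R) r ` closure (blinfun_apply A ` cball 0 1)"
    by auto
qed

text \<open>
The only form in which compactness enters the search for an extremal vector.
\<close>

lemma compact_operators_convergent_subsequence:
  assumes A: "A \<in> compact_operators" and x: "\<And>n. norm (x n) \<le> 1"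
  obtains r l where "strict_mono (r :: nat \<Rightarrow> nat)" "(\<lambda>n. A (x (r n))) \<longlonglongrightarrow> l"
proof -
  have "seq_compact (closure (blinfun_apply A ` cball 0 1))"
    by (intro compact_imp_seq_compact compact_operatorsD A)
  moreover have "A (x n) \<in> closure (blinfun_apply A ` cball 0 1)" for n
    using x[of n] closure_subset[of "blinfun_apply A ` cball 0 1"] by auto
  ultimately obtain l r where "strict_mono (r :: nat \<Rightarrow> nat)" "((\<lambda>n. A (x n)) \<circ> r) \<longlonglongrightarrow> l"
    using seq_compactE[of "closure (blinfun_apply A ` cball 0 1)" "\<lambda>n. A (x n)"] by blast
  then show ?thesis using that by (simp add: o_def)
qed

lemma unitary_operatorsD:
  assumes U: "U \<in> unitary_operators"
  shows "complex_linear U" "U (cadjoint U x) = x" "cadjoint U (U x) = x"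
    "inner (U x) y = inner x (cadjoint U y)" "inner (U x) (U y) = inner x y" "norm (U x) = norm x"
    "norm (cadjoint U x) = norm x" "complex_linear (cadjoint U)"
proof -
  show lin: "complex_linear U" using U by (simp add: unitary_operators_def)
  have inv: "U o\<^sub>L cadjoint U = id_blinfun" "cadjoint U o\<^sub>L U = id_blinfun"
    using U by (simp_all add: unitary_operators_def)
  show inv': "U (cadjoint U x) = x" "cadjoint U (U x) = x" for x
    using inv[THEN arg_cong, of "\<lambda>F. blinfun_apply F x"] by simp_all
  show adj: "inner (U x) y = inner x (cadjoint U y)" for x y
    using is_cadjoint_cadjoint[OF lin] by (simp add: is_cadjoint_def Re_cinner[symmetric])
  then show "inner (U x) (U y) = inner x y" for x y by (simp add: inv')
  then show norm: "norm (U x) = norm x" for x by (simp add: norm_eq_sqrt_inner)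
  from norm[of "cadjoint U x"] show "norm (cadjoint U x) = norm x" by (simp add: inv')
  show "complex_linear (cadjoint U)" by (rule complex_linear_inverse[OF lin inv])
qed

text \<open>
The adjoint is only characterised implicitly, so unitarity is reached by exhibiting an inverse: for
a complex linear map that preserves the real inner product, the inverse is the adjoint.
\<close>

lemma unitary_operatorsI:
  fixes U V :: "'a::complex_hilbert_space \<Rightarrow>\<^sub>L 'a"
  assumes lin: "complex_linear U" and inner: "\<And>x y. inner (U x) (U y) = inner x y"
    and UV: "\<And>x. U (V x) = x" and VU: "\<And>x. V (U x) = x"
  shows "U \<in> unitary_operators"
proof -
  have cinner: "cinner (U x) (U y) = cinner x y" for x y
  proof (rule complex_eqI)
    show "Re (cinner (U x) (U y)) = Re (cinner x y)" by (simp add: Re_cinner inner)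
    show "Im (cinner (U x) (U y)) = Im (cinner x y)"
      using lin inner[of "\<i> *\<^sub>C x" y] by (simp add: Im_cinner complex_linear_def)
  qed
  have "is_cadjoint U V"
    unfolding is_cadjoint_def by (metis cinner UV)
  then have "cadjoint U = V"
    using is_cadjoint_unique is_cadjoint_cadjoint[OF lin] by blast
  then show ?thesis
    using lin UV VU by (auto simp: unitary_operators_def intro!: blinfun_eqI)
qed

section \<open>The Cayley curve\<close>

text \<open>
The inverse of \<open>1 - A\<close> when \<open>norm A < 1\<close>.
\<close>

definition neumann :: "('a::real_normed_vector \<Rightarrow>\<^sub>L 'a) \<Rightarrow> 'a \<Rightarrow>\<^sub>L 'a"
  where "neumann A = (\<Sum>n. (((o\<^sub>L) A) ^^ n) id_blinfun)"

lemma blinfun_power_commute: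
  "(((o\<^sub>L) A) ^^ n) id_blinfun o\<^sub>L A = A o\<^sub>L (((o\<^sub>L) A) ^^ n) id_blinfun"
proof (induction n)
  case (Suc n)
  then have "(((o\<^sub>L) A) ^^ n) id_blinfun (A x) = A ((((o\<^sub>L) A) ^^ n) id_blinfun x)" for x
    by (metis blinfun_apply_blinfun_compose)
  then show ?case by (auto intro!: blinfun_eqI)
qed (auto intro!: blinfun_eqI)

lemma neumann_inverse:
  fixes A :: "'a::banach \<Rightarrow>\<^sub>L 'a"
  assumes A: "norm A < 1"
  shows "(id_blinfun - A) o\<^sub>L neumann A = id_blinfun" "neumann A o\<^sub>L (id_blinfun - A) = id_blinfun"
proof -
  let ?P = "\<lambda>n. (((o\<^sub>L) A) ^^ n) id_blinfun"
  have summable: "summable ?P"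
    by (rule summable_comparison_test'[OF summable_geometric[of "norm A"]])
      (use A norm_blinfun_power_le in auto)
  have "A o\<^sub>L neumann A = (\<Sum>n. ?P (Suc n))"
    unfolding neumann_def
    by (subst bounded_linear.suminf[OF bounded_bilinear.bounded_linear_right[OF
          bounded_bilinear_blinfun_compose] summable]) simp
  moreover have "neumann A o\<^sub>L A = (\<Sum>n. ?P (Suc n))"
    unfolding neumann_def
    by (subst bounded_linear.suminf[OF bounded_bilinear.bounded_linear_left[OF
          bounded_bilinear_blinfun_compose] summable]) (simp add: blinfun_power_commute)
  moreover have "(\<Sum>n. ?P (Suc n)) = neumann A - id_blinfun"
    using suminf_split_head[OF summable] by (simp add: neumann_def)
  ultimately have *: "A o\<^sub>L neumann A = neumann A - id_blinfun"
    "neumann A o\<^sub>L A = neumann A - id_blinfun" by simp_all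
  have "A (neumann A x) = neumann A x - x" "neumann A (A x) = neumann A x - x" for x
    using *[THEN arg_cong, of "\<lambda>F. blinfun_apply F x"] by (simp_all add: blinfun.diff_left)
  then show "(id_blinfun - A) o\<^sub>L neumann A = id_blinfun"
    "neumann A o\<^sub>L (id_blinfun - A) = id_blinfun"
    by (auto intro!: blinfun_eqI simp: blinfun.diff_left blinfun.diff_right)
qed

text \<open>
The skew condition uses the real inner product; together with complex linearity it is equivalent to
\<open>k\<^sup>* = - k\<close>.
\<close>

locale skew_contraction =
  fixes k :: "'a::complex_hilbert_space \<Rightarrow>\<^sub>L 'a"
  assumes complex_linear: "complex_linear k"
    and skew: "inner (k x) y = - inner x (k y)"
    and contraction: "norm k < 1"
begin

text \<open>
The inverse of \<open>1 - t k\<close>.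
\<close>

definition resolvent :: "real \<Rightarrow> 'a \<Rightarrow>\<^sub>L 'a"
  where "resolvent t = neumann (t *\<^sub>R k)"

text \<open>
Equal to \<open>(1 + t k) (1 - t k)\<^sup>-\<^sup>1\<close>, as \<open>cayley_apply\<close> shows; this form is affine in the resolvent
and therefore easy to differentiate.
\<close>

definition cayley :: "real \<Rightarrow> 'a \<Rightarrow>\<^sub>L 'a"
  where "cayley t = 2 *\<^sub>R resolvent t - id_blinfun"

context
  fixes t :: real
  assumes t: "\<bar>t\<bar> \<le> 1"
begin

lemma norm_scaled_less_1: "norm (t *\<^sub>R k) < 1"
  using t contraction mult_right_mono[OF t norm_ge_zero[of k]] by simp

lemma resolvent_inverse: "resolvent t (x - t *\<^sub>R k x) = x" "resolvent t x - t *\<^sub>R k (resolvent t x) = x"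
  using neumann_inverse[OF norm_scaled_less_1, THEN arg_cong, of "\<lambda>F. blinfun_apply F x"]
  by (simp_all add: resolvent_def blinfun.diff_left blinfun.scaleR_left)

lemma complex_linear_resolvent: "complex_linear (resolvent t)"
  unfolding resolvent_def
  by (rule complex_linear_inverse[OF _ neumann_inverse[OF norm_scaled_less_1]])
    (intro complex_linear_simps complex_linear)

lemma resolvent_commute: "resolvent t (k x) = k (resolvent t x)"
proof -
  have "k x = k (resolvent t x) - t *\<^sub>R k (k (resolvent t x))"
    by (metis resolvent_inverse(2) blinfun.diff_right blinfun.scaleR_right)
  then show ?thesis by (metis resolvent_inverse(1))
qed

lemma norm_one_plus: "(norm (x + t *\<^sub>R k x))\<^sup>2 = (norm x)\<^sup>2 + t\<^sup>2 * (norm (k x))\<^sup>2"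
  and norm_one_minus: "(norm (x - t *\<^sub>R k x))\<^sup>2 = (norm x)\<^sup>2 + t\<^sup>2 * (norm (k x))\<^sup>2"
proof -
  have "inner x (k x) = 0" using skew[of x x] by (simp add: inner_commute)
  then show "(norm (x + t *\<^sub>R k x))\<^sup>2 = (norm x)\<^sup>2 + t\<^sup>2 * (norm (k x))\<^sup>2"
    "(norm (x - t *\<^sub>R k x))\<^sup>2 = (norm x)\<^sup>2 + t\<^sup>2 * (norm (k x))\<^sup>2"
    unfolding power2_norm_eq_inner
    by (simp_all add: inner_add_left inner_add_right inner_diff_left inner_diff_right inner_commute
        power2_eq_square)
qed

lemma norm_resolvent: "norm (resolvent t) \<le> 1"
proof (rule norm_blinfun_bound)
  fix x
  have "(norm (resolvent t x))\<^sup>2 \<le> (norm (resolvent t x - t *\<^sub>R k (resolvent t x)))\<^sup>2"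
    by (simp add: norm_one_minus)
  then show "norm (resolvent t x) \<le> 1 * norm x" by (simp add: resolvent_inverse power2_le_iff_abs_le)
qed simp

lemma cayley_apply: "cayley t (x - t *\<^sub>R k x) = x + t *\<^sub>R k x"
proof -
  have "cayley t (x - t *\<^sub>R k x) = 2 *\<^sub>R x - (x - t *\<^sub>R k x)"
    by (simp only: cayley_def blinfun.diff_left blinfun.scaleR_left resolvent_inverse
        blinfun_apply_id_blinfun)
  then show ?thesis by (simp add: scaleR_2)
qed

lemma inner_cayley: "inner (cayley t x) (cayley t y) = inner x y"
proof -
  define x' y' where "x' = resolvent t x" and "y' = resolvent t y"
  have *: "x = x' - t *\<^sub>R k x'" "y = y' - t *\<^sub>R k y'"
    by (simp_all add: x'_def y'_def resolvent_inverse)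
  have "inner (cayley t x) (cayley t y) = inner (x' + t *\<^sub>R k x') (y' + t *\<^sub>R k y')"
    unfolding * cayley_apply ..
  also have "\<dots> = inner x y"
    unfolding * using skew[of x' y']
    by (simp add: inner_add_left inner_add_right inner_diff_left inner_diff_right algebra_simps)
  finally show ?thesis .
qed

text \<open>
The operator is the derivative of the Cayley curve.  For skew \<open>k\<close> it has the same norm as
\<open>2 k (1 - t\<^sup>2 k\<^sup>2)\<^sup>-\<^sup>1\<close>, whose spectral values \<open>2 \<kappa> / (1 + t\<^sup>2 \<kappa>\<^sup>2)\<close> increase with \<open>\<kappa>\<close> as long
as \<open>t \<kappa> \<le> 1\<close>.  The spectral theorem is avoided: with \<open>x = (1 - t k)\<^sup>2 y\<close> the Cauchy-Schwarz
inequality gives \<open>\<parallel>y\<parallel>\<^sup>2 + t\<^sup>2 \<parallel>k y\<parallel>\<^sup>2 \<le> \<parallel>x\<parallel> \<parallel>y\<parallel>\<close>, and the monotonicity becomes the elementary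
inequality \<open>0 \<le> (K \<parallel>y\<parallel> - \<parallel>k y\<parallel>) (\<parallel>y\<parallel> - t\<^sup>2 K \<parallel>k y\<parallel>)\<close>.
\<close>

lemma speed_bound:
  assumes K: "norm k \<le> K" "K \<le> 1"
  shows "norm (2 *\<^sub>R (resolvent t o\<^sub>L k o\<^sub>L resolvent t)) \<le> 2 * K / (1 + t\<^sup>2 * K\<^sup>2)"
proof -
  have K0: "K \<ge> 0" using K norm_ge_zero[of k] by linarith
  have pos: "1 + t\<^sup>2 * K\<^sup>2 > 0" by (simp add: add_pos_nonneg)
  have "norm (resolvent t (k (resolvent t x))) \<le> K / (1 + t\<^sup>2 * K\<^sup>2) * norm x" for x
  proof -
    define w y where "w = resolvent t x" and "y = resolvent t w"
    have x: "x = w - t *\<^sub>R k w" and w: "w = y - t *\<^sub>R k y"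
      by (simp_all add: w_def y_def resolvent_inverse)
    let ?a = "norm y" and ?b = "norm (k y)"
    have b: "?b \<le> K * ?a"
      using norm_blinfun[of k y] mult_right_mono[OF K(1), of ?a] by simp
    \<comment> \<open>\<open>1 + t k\<close> and \<open>1 - t k\<close> stretch every vector by the same factor, as \<open>k\<close> is skew\<close>
    have norm_x: "norm x = norm (w + t *\<^sub>R k w)"
      by (rule power2_eq_imp_eq) (simp_all add: x norm_one_minus norm_one_plus)
    have "inner (w + t *\<^sub>R k w) y = ?a\<^sup>2 + t\<^sup>2 * ?b\<^sup>2"
      using skew[of y "y"] skew[of "k y" y] unfolding w power2_norm_eq_inner
      by (simp add: blinfun.diff_right blinfun.scaleR_right inner_add_left inner_diff_left
          power2_eq_square algebra_simps)
    moreover have "inner (w + t *\<^sub>R k w) y \<le> norm x * ?a"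
      unfolding norm_x by (rule norm_cauchy_schwarz)
    ultimately have *: "?a\<^sup>2 + t\<^sup>2 * ?b\<^sup>2 \<le> norm x * ?a" by simp
    have "?b * (1 + t\<^sup>2 * K\<^sup>2) \<le> K * norm x"
    proof (cases "?a = 0")
      case True
      then show ?thesis using K0 by simp
    next
      case False
      have "t\<^sup>2 * K\<^sup>2 \<le> 1"
        using t K K0 by (intro mult_le_one) (auto simp: power_le_one abs_square_le_1)
      then have "t\<^sup>2 * K\<^sup>2 * ?a \<le> ?a" by (simp add: mult_left_le_one_le)
      moreover have "(t\<^sup>2 * K) * ?b \<le> (t\<^sup>2 * K) * (K * ?a)"
        by (intro mult_left_mono b) (use K0 in simp)
      ultimately have "t\<^sup>2 * K * ?b \<le> ?a" by (simp add: power2_eq_square mult.assoc)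
      \<comment> \<open>both factors are nonnegative; expanding the product gives the claim\<close>
      then have "0 \<le> (K * ?a - ?b) * (?a - t\<^sup>2 * K * ?b)"
        using b by simp
      then have "?a * (?b * (1 + t\<^sup>2 * K\<^sup>2)) \<le> K * (?a\<^sup>2 + t\<^sup>2 * ?b\<^sup>2)"
        by (simp add: power2_eq_square algebra_simps)
      also have "\<dots> \<le> K * (norm x * ?a)" by (rule mult_left_mono[OF * K0])
      finally have "?a * (?b * (1 + t\<^sup>2 * K\<^sup>2)) \<le> ?a * (K * norm x)" by (simp add: mult_ac)
      then show ?thesis using False by (simp add: mult_le_cancel_left)
    qed
    then have "?b \<le> K * norm x / (1 + t\<^sup>2 * K\<^sup>2)" using pos by (simp add: pos_le_divide_eq)
    moreover have "resolvent t (k (resolvent t x)) = k y" by (simp add: resolvent_commute y_def w_def)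
    ultimately show ?thesis by simp
  qed
  then have "norm (resolvent t o\<^sub>L k o\<^sub>L resolvent t) \<le> K / (1 + t\<^sup>2 * K\<^sup>2)"
    by (intro norm_blinfun_bound) (use K0 pos in auto)
  then show ?thesis by simp
qed

end

lemma cayley_inverse: "\<bar>t\<bar> \<le> 1 \<Longrightarrow> cayley t (cayley (- t) x) = x"
  using cayley_apply[of t "resolvent (- t) x"] cayley_apply[of "- t" "resolvent (- t) x"] resolvent_inverse(2)[of "- t" x]
  by simp

lemma complex_linear_cayley: "\<bar>t\<bar> \<le> 1 \<Longrightarrow> complex_linear (cayley t)"
  unfolding cayley_def by (intro complex_linear_simps complex_linear_resolvent)

lemma cayley_minus_id:
  assumes "\<bar>t\<bar> \<le> 1"
  shows "cayley t - id_blinfun = (2 * t) *\<^sub>R (k o\<^sub>L resolvent t)"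
proof (rule blinfun_eqI)
  fix x
  have "2 *\<^sub>R y - x - x = (2 * t) *\<^sub>R k y" if "y - t *\<^sub>R k y = x" for y
    unfolding that[symmetric] scaleR_2 mult_2 scaleR_add_left by (simp add: algebra_simps)
  from this[OF resolvent_inverse(2)[OF assms]]
  show "(cayley t - id_blinfun) x = ((2 * t) *\<^sub>R (k o\<^sub>L resolvent t)) x"
    by (simp add: cayley_def blinfun.diff_left blinfun.scaleR_left)
qed

text \<open>
The resolvent identity; continuity and differentiability of the resolvent both follow from it.
\<close>

lemma resolvent_diff:
  assumes "\<bar>s\<bar> \<le> 1" "\<bar>t\<bar> \<le> 1"
  shows "resolvent s - resolvent t = (s - t) *\<^sub>R (resolvent s o\<^sub>L k o\<^sub>L resolvent t)"
proof (rule blinfun_eqI)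
  fix x
  define y where "y = resolvent t x"
  have x: "x = y - t *\<^sub>R k y" using resolvent_inverse(2)[OF assms(2)] by (simp add: y_def)
  have "resolvent s x - y = resolvent s x - resolvent s (y - s *\<^sub>R k y)"
    by (simp only: resolvent_inverse(1)[OF assms(1)])
  also have "\<dots> = resolvent s (x - (y - s *\<^sub>R k y))"
    by (simp only: blinfun.diff_right)
  also have "x - (y - s *\<^sub>R k y) = (s - t) *\<^sub>R k y" by (simp add: x algebra_simps)
  finally show "(resolvent s - resolvent t) x = ((s - t) *\<^sub>R (resolvent s o\<^sub>L k o\<^sub>L resolvent t)) x"
    by (simp add: y_def blinfun.diff_left blinfun.scaleR_left blinfun.scaleR_right)
qed

lemma norm_resolvent_diff:
  assumes "\<bar>s\<bar> \<le> 1" "\<bar>t\<bar> \<le> 1"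
  shows "norm (resolvent s - resolvent t) \<le> \<bar>s - t\<bar>"
proof -
  have "norm (resolvent s o\<^sub>L k o\<^sub>L resolvent t) \<le> norm (resolvent s o\<^sub>L k) * norm (resolvent t)" by (rule norm_blinfun_compose)
  also have "\<dots> \<le> (norm (resolvent s) * norm k) * norm (resolvent t)"
    by (intro mult_right_mono norm_blinfun_compose norm_ge_zero)
  also have "\<dots> \<le> 1"
    using norm_resolvent[OF assms(1)] norm_resolvent[OF assms(2)] contraction by (intro mult_le_one) auto
  finally show ?thesis
    using resolvent_diff[OF assms] mult_left_mono[of "norm (resolvent s o\<^sub>L k o\<^sub>L resolvent t)" 1 "\<bar>s - t\<bar>"] by simp
qed

text \<open>
Applying the resolvent identity twice leaves an error of order \<open>\<bar>s - t\<bar>\<^sup>2\<close>.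
\<close>

lemma has_vector_derivative_resolvent:
  assumes "t \<in> {0..1}"
  shows "(resolvent has_vector_derivative (resolvent t o\<^sub>L k o\<^sub>L resolvent t)) (at t within {0..1})"
  unfolding has_vector_derivative_def
proof (rule has_derivativeI_sandwich[where e = 1 and H = "\<lambda>s. \<bar>s - t\<bar>"])
  show "bounded_linear (\<lambda>h. h *\<^sub>R (resolvent t o\<^sub>L k o\<^sub>L resolvent t))" by (rule bounded_linear_scaleR_left)
  show "((\<lambda>s. \<bar>s - t\<bar>) \<longlongrightarrow> 0) (at t within {0..1})"
    by (rule tendsto_eq_intros refl | simp)+
  fix s :: real assume s: "s \<in> {0..1}" "s \<noteq> t"
  have st: "\<bar>s\<bar> \<le> 1" "\<bar>t\<bar> \<le> 1" using s assms by auto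
  let ?D = "resolvent s - resolvent t"
  have "?D - (s - t) *\<^sub>R (resolvent t o\<^sub>L k o\<^sub>L resolvent t) = (s - t) *\<^sub>R (?D o\<^sub>L k o\<^sub>L resolvent t)"
    by (rule trans[OF arg_cong[OF resolvent_diff[OF st]]])
      (auto intro!: blinfun_eqI simp: blinfun.bilinear_simps scaleR_diff_right)
  moreover have "norm (?D o\<^sub>L k o\<^sub>L resolvent t) \<le> \<bar>s - t\<bar>"
  proof -
    have "norm (?D o\<^sub>L k o\<^sub>L resolvent t) \<le> (norm ?D * norm k) * norm (resolvent t)"
      by (rule order_trans[OF norm_blinfun_compose])
        (intro mult_right_mono norm_blinfun_compose norm_ge_zero)
    also have "\<dots> \<le> norm ?D * 1 * 1"
      using norm_resolvent[OF st(2)] contraction by (intro mult_mono) auto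
    finally show ?thesis using norm_resolvent_diff[OF st] by simp
  qed
  ultimately show "norm (resolvent s - resolvent t - (s - t) *\<^sub>R (resolvent t o\<^sub>L k o\<^sub>L resolvent t)) / norm (s - t) \<le> \<bar>s - t\<bar>"
    using s by simp
qed simp

lemma continuous_on_resolvent: "continuous_on {0..1} resolvent"
  by (rule continuous_on_vector_derivative) (rule has_vector_derivative_resolvent)

end

section \<open>The distance as an angle\<close>

lemma piecewise_smooth_curve_on_imp_le:
  assumes "piecewise_smooth_curve_on a b \<gamma>"
  shows "a \<le> b"
proof -
  obtain n :: nat and p where p: "p 0 = a" "p n = b" "\<And>i. i < n \<Longrightarrow> p i < p (Suc i)"
    using assms unfolding piecewise_smooth_curve_on_def by metis
  have "p 0 \<le> p k" if "k \<le> n" for k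
    using that p(3) by (induction k) (auto intro: order_trans less_imp_le simp: Suc_le_eq)
  then show ?thesis using p(1,2) by auto
qed

text \<open>
Apply \<open>arccos_increment_le_arclength\<close> to the image of \<open>x\<close> along the curve and let \<open>\<rho>\<close> tend to
\<open>1\<close>.
\<close>

lemma d_inf_ge_angle:
  fixes u v :: "'a::complex_hilbert_space \<Rightarrow>\<^sub>L 'a"
  assumes x: "norm x = 1"
  shows "ereal (arccos (inner (u x) (v x))) \<le> d_inf u v"
  unfolding d_inf_def
proof (rule Inf_greatest, clarify)
  fix a b \<gamma>
  assume curve: "piecewise_smooth_curve_on a b \<gamma>" and group: "\<gamma> ` {a..b} \<subseteq> fredholm_unitary_group"
    and u: "u = \<gamma> a" and v: "v = \<gamma> b"
  have ab: "a \<le> b" by (rule piecewise_smooth_curve_on_imp_le[OF curve])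
  have sphere: "norm (\<gamma> t x) = 1" if "t \<in> {a..b}" for t
    using group that x unitary_operatorsD(6)[of "\<gamma> t" x]
    by (auto simp: fredholm_unitary_group_def image_subset_iff)
  have bound: "arccos (\<rho> * inner (u x) (v x)) - arccos \<rho> \<le> curve_length a b \<gamma>"
    if \<rho>: "0 \<le> \<rho>" "\<rho> < 1" for \<rho>
  proof -
    have "arccos (\<rho> * inner (u x) (\<gamma> b x)) - arccos (\<rho> * inner (u x) (\<gamma> a x)) \<le> curve_length a b \<gamma>"
    proof (rule curve_length_ge_increment[OF curve])
      fix c d \<gamma>'
      assume cd: "a \<le> c" "c < d" "d \<le> b" and cont: "continuous_on {c..d} \<gamma>'"
        and \<gamma>': "\<And>t. t \<in> {c..d} \<Longrightarrow> (\<gamma> has_vector_derivative \<gamma>' t) (at t within {c..d})"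
      show "arccos (\<rho> * inner (u x) (\<gamma> d x)) - arccos (\<rho> * inner (u x) (\<gamma> c x))
          \<le> integral {c..d} (\<lambda>t. norm (\<gamma>' t))"
      proof (rule arccos_increment_le_arclength[OF \<open>c < d\<close> _ _ _ _ _ \<rho>])
        show "((\<lambda>t. \<gamma> t x) has_vector_derivative \<gamma>' t x) (at t within {c..d})" if "t \<in> {c..d}" for t
          by (rule bounded_linear.has_vector_derivative[OF blinfun.bounded_linear_left \<gamma>'[OF that]])
        show "norm (\<gamma>' t x) \<le> norm (\<gamma>' t)" for t
          using norm_blinfun[of "\<gamma>' t" x] x by simp
        show "continuous_on {c..d} (\<lambda>t. norm (\<gamma>' t))" by (intro continuous_intros cont)
        show "norm (u x) = 1" unfolding u by (rule sphere) (use ab in simp)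
        show "norm (\<gamma> t x) = 1" if "t \<in> {c..d}" for t by (rule sphere) (use that cd in auto)
      qed
    qed
    moreover have "inner (u x) (\<gamma> a x) = 1"
      using sphere[of a] ab by (simp add: u dot_square_norm)
    ultimately show ?thesis by (simp add: v)
  qed
  have range: "\<bar>inner (u x) (v x)\<bar> \<le> 1"
    using Cauchy_Schwarz_ineq2[of "u x" "v x"] sphere[of a] sphere[of b] ab by (simp add: u v)
  have "(\<lambda>n. arccos (real n / real (Suc n) * inner (u x) (v x)) - arccos (real n / real (Suc n)))
      \<longlonglongrightarrow> arccos (1 * inner (u x) (v x)) - arccos 1"
  proof (intro tendsto_diff continuous_on_tendsto_compose[OF continuous_on_arccos'])
    show "(\<lambda>n. real n / real (Suc n) * inner (u x) (v x)) \<longlonglongrightarrow> 1 * inner (u x) (v x)"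
      by (intro tendsto_intros LIMSEQ_n_over_Suc_n)
    show "(\<lambda>n. real n / real (Suc n)) \<longlonglongrightarrow> 1" by (rule LIMSEQ_n_over_Suc_n)
    have frac: "0 \<le> real n / real (Suc n)" "real n / real (Suc n) \<le> 1" for n by simp_all
    have "\<bar>real n / real (Suc n) * inner (u x) (v x)\<bar> \<le> 1" for n
      unfolding abs_mult using frac[of n] range by (intro mult_le_one) auto
    then have "real n / real (Suc n) * inner (u x) (v x) \<in> {-1..1}" for n
      by (metis abs_le_iff atLeastAtMost_iff minus_le_iff)
    then show "\<forall>\<^sub>F n in sequentially. real n / real (Suc n) * inner (u x) (v x) \<in> {-1..1}"
      by (intro always_eventually allI)
    show "\<forall>\<^sub>F n in sequentially. real n / real (Suc n) \<in> {-1..1}"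
      by (intro always_eventually allI) (use frac in \<open>auto intro: order_trans[of _ 0]\<close>)
  qed (use range in auto)
  then have "arccos (1 * inner (u x) (v x)) - arccos 1 \<le> curve_length a b \<gamma>"
    by (rule LIMSEQ_le_const2) (intro exI[of _ 0] allI impI bound, auto)
  then show "ereal (arccos (inner (\<gamma> a x) (\<gamma> b x))) \<le> ereal (curve_length a b \<gamma>)"
    by (simp add: u v)
qed

text \<open>
A constant curve on a proper interval is not smooth, having zero derivative; the one-point curve
joins \<open>u\<close> to itself with length \<open>0\<close>.
\<close>

lemma d_inf_same:
  assumes "u \<in> fredholm_unitary_group"
  shows "d_inf u u = 0"
proof (rule antisym)
  have "piecewise_smooth_curve_on 0 0 (\<lambda>_::real. u)"
    unfolding piecewise_smooth_curve_on_def
    by (rule exI[of _ 0], rule exI[of _ "\<lambda>_. 0"]) simp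
  moreover have "curve_length 0 0 (\<lambda>_::real. u) = 0" by (simp add: curve_length_def)
  ultimately show "d_inf u u \<le> 0"
    unfolding d_inf_def by (intro Inf_lower CollectI exI[of _ 0] exI[of _ "\<lambda>_. u"])
      (use assms in auto)
  show "0 \<le> d_inf u u"
    unfolding d_inf_def by (intro Inf_greatest) (auto simp: curve_length_nonneg)
qed

lemma d_inf_le_length:
  assumes "smooth_curve_on 0 1 \<gamma>" and "\<And>t. t \<in> {0..1} \<Longrightarrow> \<gamma> t \<in> fredholm_unitary_group"
  shows "d_inf (\<gamma> 0) (\<gamma> 1) \<le> ereal (curve_length 0 1 \<gamma>)"
proof -
  have "piecewise_smooth_curve_on 0 1 \<gamma>"
    unfolding piecewise_smooth_curve_on_def
    by (rule exI[of _ 1], rule exI[of _ real]) (use assms in auto)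
  then show ?thesis
    unfolding d_inf_def using assms(2)
    by (intro Inf_lower CollectI exI[of _ 0] exI[of _ 1] exI[of _ \<gamma>]) auto
qed

context skew_contraction
begin

text \<open>
The derivative of the Cayley curve vanishes only for \<open>k = 0\<close>, when the end points coincide.
Otherwise its speed is at most \<open>2 K / (1 + t\<^sup>2 K\<^sup>2)\<close>, the derivative of \<open>2 arctan (t K)\<close>.
\<close>

lemma d_inf_cayley_le:
  assumes u: "u \<in> fredholm_unitary_group" and compact: "k \<in> compact_operators"
    and K: "norm k \<le> K" "K \<le> 1"
  shows "d_inf u (u o\<^sub>L cayley 1) \<le> ereal (2 * arctan K)"
proof (cases "k = 0")
  case True
  have "cayley 1 - id_blinfun = (2 * 1) *\<^sub>R (k o\<^sub>L resolvent 1)" by (rule cayley_minus_id) simp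
  then have "cayley 1 = id_blinfun" by (simp add: True)
  then have "u o\<^sub>L cayley 1 = u" by (auto intro: blinfun_eqI)
  moreover have "0 \<le> arctan K" using K(1) by (simp add: True)
  ultimately show ?thesis using d_inf_same[OF u] by simp
next
  case False
  have u_unit: "u \<in> unitary_operators" and u_compact: "u - id_blinfun \<in> compact_operators"
    using u by (auto simp: fredholm_unitary_group_def)
  note u_simps = unitary_operatorsD[OF u_unit]
  define \<gamma> where "\<gamma> t = u o\<^sub>L cayley t" for t
  define \<gamma>' where "\<gamma>' t = u o\<^sub>L (2 *\<^sub>R (resolvent t o\<^sub>L k o\<^sub>L resolvent t))" for t
  have der: "(\<gamma> has_vector_derivative \<gamma>' t) (at t within {0..1})" if t: "t \<in> {0..1}" for t
  proof -
    have "((\<lambda>t. 2 *\<^sub>R resolvent t - id_blinfun) has_vector_derivative 2 *\<^sub>R (resolvent t o\<^sub>L k o\<^sub>L resolvent t) - 0)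
        (at t within {0..1})"
      by (intro has_vector_derivative_diff has_vector_derivative_const
          bounded_linear.has_vector_derivative[OF bounded_linear_scaleR_right]
          has_vector_derivative_resolvent t)
    then have "(cayley has_vector_derivative 2 *\<^sub>R (resolvent t o\<^sub>L k o\<^sub>L resolvent t)) (at t within {0..1})"
      unfolding cayley_def by simp
    from bounded_linear.has_vector_derivative[OF bounded_bilinear.bounded_linear_right[OF
          bounded_bilinear_blinfun_compose] this]
    show ?thesis unfolding \<gamma>_def \<gamma>'_def .
  qed
  have cont: "continuous_on {0..1} \<gamma>'"
    unfolding \<gamma>'_def
    by (intro bounded_bilinear.continuous_on[OF bounded_bilinear_blinfun_compose]
        continuous_on_scaleR continuous_on_const continuous_on_resolvent)
  have nonzero: "\<gamma>' t \<noteq> 0" if t: "t \<in> {0..1}" for t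
  proof
    have t': "\<bar>t\<bar> \<le> 1" using t by auto
    assume zero: "\<gamma>' t = 0"
    have "k y = 0" for y
    proof -
      have "u (2 *\<^sub>R resolvent t (k (resolvent t (y - t *\<^sub>R k y)))) = 0"
        using arg_cong[OF zero, of "\<lambda>F. blinfun_apply F (y - t *\<^sub>R k y)"]
        by (simp add: \<gamma>'_def blinfun.scaleR_left)
      then have "resolvent t (k y) = 0"
        using u_simps(6)[of "2 *\<^sub>R resolvent t (k y)"] by (simp add: resolvent_inverse(1)[OF t'])
      then show ?thesis using resolvent_inverse(2)[OF t', of "k y"] by simp
    qed
    then have "k = 0" by (intro blinfun_eqI) simp
    with False show False by blast
  qed
  have smooth: "smooth_curve_on 0 1 \<gamma>"
    unfolding smooth_curve_on_def using der nonzero cont by blast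
  have group: "\<gamma> t \<in> fredholm_unitary_group" if t: "t \<in> {0..1}" for t
  proof -
    have t': "\<bar>t\<bar> \<le> 1" "\<bar>- t\<bar> \<le> 1" using t by auto
    have "\<gamma> t \<in> unitary_operators"
    proof (rule unitary_operatorsI[where V = "cayley (- t) o\<^sub>L cadjoint u"])
      show "complex_linear (\<gamma> t)"
        unfolding \<gamma>_def by (intro complex_linear_simps u_simps complex_linear_cayley t')
      show "inner (\<gamma> t x) (\<gamma> t y) = inner x y" for x y
        by (simp add: \<gamma>_def u_simps(5) inner_cayley[OF t'(1)])
      show "\<gamma> t ((cayley (- t) o\<^sub>L cadjoint u) x) = x" for x
        by (simp add: \<gamma>_def cayley_inverse[OF t'(1)] u_simps(2))
      show "(cayley (- t) o\<^sub>L cadjoint u) (\<gamma> t x) = x" for x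
        using cayley_inverse[OF t'(2)] by (simp add: \<gamma>_def u_simps(3))
    qed
    have *: "\<gamma> t - id_blinfun = (u - id_blinfun) + (u o\<^sub>L (cayley t - id_blinfun))"
      by (rule blinfun_eqI) (simp add: \<gamma>_def blinfun.add_left blinfun.diff_left blinfun.diff_right)
    have "\<gamma> t - id_blinfun \<in> compact_operators"
      unfolding * cayley_minus_id[OF t'(1)]
      by (intro compact_operators_add u_compact compact_operators_compose_left u_simps(1)
          compact_operators_scaleR compact_operators_compose_right compact complex_linear_resolvent t')
    with \<open>\<gamma> t \<in> unitary_operators\<close> show ?thesis by (simp add: fredholm_unitary_group_def)
  qed
  have "curve_length 0 1 \<gamma> \<le> 2 * arctan K"
  proof -
    have vd: "vector_derivative \<gamma> (at t within {0..1}) = \<gamma>' t" if "t \<in> {0..1}" for t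
      using vector_derivative_within_cbox[of 0 1 t \<gamma> "\<gamma>' t"] der[OF that] that by simp
    have "curve_length 0 1 \<gamma> = integral {0..1} (\<lambda>t. norm (\<gamma>' t))"
      unfolding curve_length_def by (rule integral_cong) (simp add: vd)
    moreover have "((\<lambda>t. norm (\<gamma>' t)) has_integral integral {0..1} (\<lambda>t. norm (\<gamma>' t))) {0..1}"
      by (intro integrable_integral integrable_continuous_real continuous_intros cont)
    moreover have "((\<lambda>t. 2 * K / (1 + t\<^sup>2 * K\<^sup>2)) has_integral 2 * arctan (1 * K) - 2 * arctan (0 * K)) {0..1}"
    proof (rule fundamental_theorem_of_calculus)
      fix t :: real
      show "((\<lambda>t. 2 * arctan (t * K)) has_vector_derivative 2 * K / (1 + t\<^sup>2 * K\<^sup>2)) (at t within {0..1})"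
        unfolding has_real_derivative_iff_has_vector_derivative[symmetric]
        by (auto intro!: derivative_eq_intros simp: power_mult_distrib field_simps)
    qed simp
    moreover have "norm (\<gamma>' t) \<le> 2 * K / (1 + t\<^sup>2 * K\<^sup>2)" if "t \<in> {0..1}" for t
    proof -
      have t': "\<bar>t\<bar> \<le> 1" using that by auto
      have "norm (\<gamma>' t) \<le> norm (2 *\<^sub>R (resolvent t o\<^sub>L k o\<^sub>L resolvent t))"
        unfolding \<gamma>'_def by (rule norm_blinfun_bound) (simp_all add: u_simps(6) norm_blinfun del: norm_scaleR)
      also have "\<dots> \<le> 2 * K / (1 + t\<^sup>2 * K\<^sup>2)" by (rule speed_bound[OF t' K])
      finally show ?thesis .
    qed
    ultimately show ?thesis
      using has_integral_le[of "\<lambda>t. norm (\<gamma>' t)" "integral {0..1} (\<lambda>t. norm (\<gamma>' t))" "{0..1}"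
          "\<lambda>t. 2 * K / (1 + t\<^sup>2 * K\<^sup>2)"] by simp
  qed
  moreover have "\<gamma> 0 = u"
  proof -
    have "cayley 0 - id_blinfun = (2 * 0) *\<^sub>R (k o\<^sub>L resolvent 0)" by (rule cayley_minus_id) simp
    then show ?thesis by (auto simp: \<gamma>_def intro: blinfun_eqI)
  qed
  moreover have "\<gamma> 1 = u o\<^sub>L cayley 1" by (simp add: \<gamma>_def)
  ultimately show ?thesis
    using d_inf_le_length[OF smooth group] by (metis ereal_less_eq(3) order_trans)
qed

end

text \<open>
With \<open>q = u\<^sup>* v\<close> the hypothesis bounds the spectrum of the real part of \<open>q\<close> from below by \<open>c\<close>.  So
\<open>1 + q\<close> is invertible, by the Neumann series in \<open>(1 - q)/2\<close>, and the Cayley transform \<open>k\<close> of \<open>q\<close>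
satisfies \<open>\<parallel>k\<parallel>\<^sup>2 \<le> (1 - c)/(1 + c)\<close>, the square of the tangent of half the angle.  The Cayley
curve of \<open>k\<close> ends at \<open>q\<close>.
\<close>

lemma d_inf_le_angle:
  fixes u v :: "'a::complex_hilbert_space \<Rightarrow>\<^sub>L 'a"
  assumes u: "u \<in> fredholm_unitary_group" and v: "v \<in> fredholm_unitary_group"
    and c: "0 < c" "c \<le> 1" and angle: "\<And>x. inner (u x) (v x) \<ge> c * (norm x)\<^sup>2"
  shows "d_inf u v \<le> ereal (arccos c)"
proof -
  have u_unit: "u \<in> unitary_operators" and v_unit: "v \<in> unitary_operators"
    and compact: "v - u \<in> compact_operators"
    using u v compact_operators_diff[of "v - id_blinfun" "u - id_blinfun"]
    by (auto simp: fredholm_unitary_group_def)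
  note u_simps = unitary_operatorsD[OF u_unit] and v_simps = unitary_operatorsD[OF v_unit]
  define q where "q = cadjoint u o\<^sub>L v"
  have q_lin: "complex_linear q" unfolding q_def by (intro complex_linear_simps u_simps v_simps)
  have q_inner: "inner (q x) (q y) = inner x y" for x y
    by (metis blinfun_apply_blinfun_compose q_def u_simps(2,5) v_simps(5))
  have q_norm: "norm (q x) = norm x" for x by (simp add: norm_eq_sqrt_inner q_inner)
  have q_angle: "inner x (q x) \<ge> c * (norm x)\<^sup>2" for x
    using angle[of x] by (simp add: q_def u_simps(4))
  have sq: "(norm (q x - x))\<^sup>2 = 2 * (norm x)\<^sup>2 - 2 * inner x (q x)"
    "(norm (q x + x))\<^sup>2 = 2 * (norm x)\<^sup>2 + 2 * inner x (q x)" for x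
    using q_inner[of x x] unfolding power2_norm_eq_inner
    by (simp_all add: inner_add_left inner_add_right inner_diff_left inner_diff_right inner_commute)
  \<comment> \<open>\<open>1 + q = 2 (1 - Q)\<close>\<close>
  define Q where "Q = (1/2) *\<^sub>R (id_blinfun - q)"
  have "norm Q \<le> sqrt ((1 - c) / 2)"
  proof (rule norm_blinfun_bound)
    fix x
    have "(norm (Q x))\<^sup>2 = (norm (q x - x))\<^sup>2 / 4"
      by (simp add: Q_def blinfun.scaleR_left blinfun.diff_left norm_minus_commute power_divide)
    also have "\<dots> \<le> (1 - c) / 2 * (norm x)\<^sup>2"
      using q_angle[of x] by (simp add: sq field_simps)
    finally have "norm (Q x) \<le> sqrt ((1 - c) / 2 * (norm x)\<^sup>2)" by (rule real_le_rsqrt)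
    then show "norm (Q x) \<le> sqrt ((1 - c) / 2) * norm x"
      by (simp only: real_sqrt_mult real_sqrt_abs abs_norm_cancel)
  qed (use c in simp)
  also have "\<dots> < 1" using c by simp
  finally have Q: "norm Q < 1" .
  define B where "B = (1/2) *\<^sub>R neumann Q"
  have "(q + id_blinfun) o\<^sub>L B = (id_blinfun - Q) o\<^sub>L neumann Q"
    "B o\<^sub>L (q + id_blinfun) = neumann Q o\<^sub>L (id_blinfun - Q)"
    by (rule blinfun_eqI, simp add: B_def Q_def blinfun.bilinear_simps algebra_simps scaleR_2
        flip: scaleR_2)+
  then have B: "(q + id_blinfun) o\<^sub>L B = id_blinfun" "B o\<^sub>L (q + id_blinfun) = id_blinfun"
    by (simp_all add: neumann_inverse[OF Q])
  have B_lin: "complex_linear B"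
    by (rule complex_linear_inverse[OF _ B]) (intro complex_linear_simps q_lin)
  have B1: "q (B x) + B x = x" and B2: "B (q x + x) = x" for x
    using B[THEN arg_cong, of "\<lambda>F. blinfun_apply F x"] by (simp_all add: blinfun.add_left)
  define k where "k = (q - id_blinfun) o\<^sub>L B"
  have k_apply: "k (q y + y) = q y - y" for y by (simp add: k_def B2 blinfun.diff_left)
  have k_compact: "k \<in> compact_operators"
  proof -
    have "q - id_blinfun = cadjoint u o\<^sub>L (v - u)"
      by (rule blinfun_eqI) (simp add: q_def blinfun.diff_left blinfun.diff_right u_simps(3))
    then show ?thesis
      unfolding k_def
      by (simp add: compact_operators_compose_right compact_operators_compose_left compact
          u_simps(8) B_lin)
  qed
  define K where "K = tan (arccos c / 2)"
  have arc: "0 \<le> arccos c" "arccos c < pi / 2"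
    using c arccos_lbound[of c] arccos_less_arccos[of 0 c] by auto
  have K: "0 \<le> K" "K < 1"
    using arc tan_monotone'[of "arccos c / 2" "pi / 4"] tan_45 unfolding K_def
    by (auto intro!: tan_pos_pi2_le)
  have K_sq: "K\<^sup>2 * (1 + c) = 1 - c"
  proof -
    have "K = sin (arccos c) / (c + 1)"
      unfolding K_def using tan_half[of "arccos c / 2"] c by simp
    moreover have "(sin (arccos c))\<^sup>2 = (1 - c) * (1 + c)"
      using c sin_cos_squared_add[of "arccos c"] by (simp add: power2_eq_square algebra_simps)
    ultimately have "(K * (1 + c))\<^sup>2 = (1 - c) * (1 + c)" using c by (simp add: add.commute)
    then have "(K\<^sup>2 * (1 + c)) * (1 + c) = (1 - c) * (1 + c)"
      by (simp only: power2_eq_square mult_ac)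
    then show ?thesis using c by (simp only: mult_cancel_right) auto
  qed
  have norm_k: "norm k \<le> K"
  proof (rule norm_blinfun_bound[OF K(1)])
    fix x
    define y where "y = B x"
    have x: "x = q y + y" by (simp add: y_def B1)
    let ?m = "inner y (q y)" and ?n = "(norm y)\<^sup>2"
    have "(1 + c) * (2 * ?n - 2 * ?m) \<le> (1 - c) * (2 * ?n + 2 * ?m)"
      using q_angle[of y] by (simp add: algebra_simps)
    also have "\<dots> = (1 + c) * (K\<^sup>2 * (2 * ?n + 2 * ?m))"
      unfolding K_sq[symmetric] by (simp add: mult_ac)
    finally have "2 * ?n - 2 * ?m \<le> K\<^sup>2 * (2 * ?n + 2 * ?m)"
      using c by (simp add: mult_le_cancel_left)
    then have "(norm (k x))\<^sup>2 \<le> (K * norm x)\<^sup>2"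
      unfolding x k_apply power_mult_distrib sq .
    then show "norm (k x) \<le> K * norm x" by (rule power2_le_imp_le) (use K in simp)
  qed
  interpret skew_contraction k
  proof
    show "complex_linear k" unfolding k_def by (intro complex_linear_simps q_lin B_lin)
    show "norm k < 1" using norm_k K by simp
    fix x y
    define x' y' where "x' = B x" and "y' = B y"
    have x: "x = q x' + x'" and y: "y = q y' + y'" by (simp_all add: x'_def y'_def B1)
    show "inner (k x) y = - inner x (k y)"
      unfolding x y k_apply
      by (simp add: inner_add_left inner_add_right inner_diff_left inner_diff_right q_inner)
  qed
  have "cayley 1 = q"
  proof (rule blinfun_eqI)
    fix x
    have "cayley 1 ((q x + x) - 1 *\<^sub>R k (q x + x)) = (q x + x) + 1 *\<^sub>R k (q x + x)"
      by (rule cayley_apply) simp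
    then have "cayley 1 (2 *\<^sub>R x) = 2 *\<^sub>R q x" unfolding k_apply by (simp add: scaleR_2)
    then show "cayley 1 x = q x" by (simp add: blinfun.scaleR_right)
  qed
  moreover have "u o\<^sub>L q = v" by (rule blinfun_eqI) (simp add: q_def u_simps(2))
  moreover have "2 * arctan K = arccos c"
    unfolding K_def using arc by (simp add: arctan_tan)
  ultimately show ?thesis using d_inf_cayley_le[OF u k_compact norm_k] K by simp
qed

section \<open>Differentiating a one-parameter group\<close>

lemma blinfun_power_scaleR:
  fixes z :: "'a::real_normed_vector \<Rightarrow>\<^sub>L 'a"
  shows "(((o\<^sub>L) (s *\<^sub>R z)) ^^ n) id_blinfun = s ^ n *\<^sub>R (((o\<^sub>L) z) ^^ n) id_blinfun"
proof (induction n)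
  case (Suc n)
  have "(s *\<^sub>R z) o\<^sub>L (s ^ n *\<^sub>R B) = s ^ Suc n *\<^sub>R (z o\<^sub>L B)" for B
    by (rule blinfun_eqI) (simp add: blinfun.scaleR_left blinfun.scaleR_right)
  then show ?case by (simp add: Suc)
qed simp

lemma blinfun_exp_scaleR:
  fixes z :: "'a::real_normed_vector \<Rightarrow>\<^sub>L 'a"
  shows "blinfun_exp (s *\<^sub>R z) = (\<Sum>n. s ^ n *\<^sub>R ((1 / fact n) *\<^sub>R (((o\<^sub>L) z) ^^ n) id_blinfun))"
  unfolding blinfun_exp_def by (simp add: blinfun_power_scaleR)

text \<open>
Composing with a functional reduces the claim to termwise differentiation of a real power series.
With \<open>z\<close> on the right of the exponential, the derivatives of \<open>inner a (exp (s z) y)\<close> are obtained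
by replacing \<open>y\<close> with \<open>z y\<close>.
\<close>

lemma DERIV_bounded_linear_blinfun_exp:
  fixes z :: "'a::banach \<Rightarrow>\<^sub>L 'a" and f :: "('a \<Rightarrow>\<^sub>L 'a) \<Rightarrow> real"
  assumes f: "bounded_linear f"
  shows "((\<lambda>s. f (blinfun_exp (s *\<^sub>R z))) has_real_derivative f (blinfun_exp (s *\<^sub>R z) o\<^sub>L z)) (at s)"
proof -
  interpret f: bounded_linear f by fact
  let ?P = "\<lambda>n. (1 / fact n) *\<^sub>R (((o\<^sub>L) z) ^^ n) id_blinfun"
  have summable: "summable (\<lambda>n. s ^ n *\<^sub>R ?P n)" for s
    using summable_blinfun_exp[of "s *\<^sub>R z"] by (simp add: blinfun_power_scaleR)
  have series: "g (blinfun_exp (s *\<^sub>R z)) = (\<Sum>n. g (?P n) * s ^ n)"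
    and summable_g: "summable (\<lambda>n. g (?P n) * s ^ n)"
    if "bounded_linear g" for g :: "('a \<Rightarrow>\<^sub>L 'a) \<Rightarrow> real" and s
  proof -
    interpret g: bounded_linear g by fact
    show "g (blinfun_exp (s *\<^sub>R z)) = (\<Sum>n. g (?P n) * s ^ n)"
      unfolding blinfun_exp_scaleR g.suminf[OF summable] by (simp only: g.scaleR real_scaleR_def mult.commute)
    show "summable (\<lambda>n. g (?P n) * s ^ n)"
      using g.summable[OF summable] by (simp only: g.scaleR real_scaleR_def mult.commute)
  qed
  have "((\<lambda>s. \<Sum>n. f (?P n) * s ^ n) has_real_derivative (\<Sum>n. diffs (\<lambda>n. f (?P n)) n * s ^ n)) (at s)"
    by (rule termdiffs_strong_converges_everywhere) (rule summable_g[OF f])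
  moreover have "diffs (\<lambda>n. f (?P n)) n = f (?P n o\<^sub>L z)" for n
  proof -
    have "diffs (\<lambda>n. f (?P n)) n = f (real (Suc n) *\<^sub>R ?P (Suc n))"
      by (simp only: diffs_def f.scaleR real_scaleR_def of_nat_Suc)
    also have "real (Suc n) *\<^sub>R ?P (Suc n) = (1 / fact n) *\<^sub>R (((o\<^sub>L) z) ^^ Suc n) id_blinfun"
      by (simp add: fact_Suc field_simps del: of_nat_Suc funpow.simps)
    also have "\<dots> = ?P n o\<^sub>L z"
      by (rule blinfun_eqI) (simp add: blinfun.scaleR_left flip: blinfun_power_commute[THEN arg_cong, of "\<lambda>F. blinfun_apply F x" for x, simplified])
    finally show ?thesis .
  qed
  moreover have comp: "bounded_linear (\<lambda>A. f (A o\<^sub>L z))"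
    by (intro bounded_linear_compose[OF f] bounded_bilinear.bounded_linear_left[OF
          bounded_bilinear_blinfun_compose])
  ultimately show ?thesis
    by (simp only: series[OF f] series[OF comp])
qed

lemma continuous_on_blinfun_exp:
  fixes z :: "'a::banach \<Rightarrow>\<^sub>L 'a"
  shows "continuous_on {0..1} (\<lambda>s. blinfun_exp (s *\<^sub>R z))"
proof -
  let ?P = "\<lambda>n. (1 / fact n) *\<^sub>R (((o\<^sub>L) z) ^^ n) id_blinfun"
  have "uniform_limit {0..1} (\<lambda>n s. \<Sum>i<n. s ^ i *\<^sub>R ?P i) (\<lambda>s. \<Sum>i. s ^ i *\<^sub>R ?P i) sequentially"
  proof (rule Weierstrass_m_test)
    show "summable (\<lambda>n. norm z ^ n /\<^sub>R fact n)" by (rule summable_exp_generic)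
    fix n :: nat and s :: real assume s: "s \<in> {0..1}"
    have "norm (s ^ n *\<^sub>R ?P n) = \<bar>s\<bar> ^ n * norm (?P n)" by (simp only: norm_scaleR power_abs)
    also have "\<dots> \<le> 1 * norm (?P n)"
      using s by (intro mult_right_mono) (auto intro: power_le_one)
    also have "\<dots> \<le> norm z ^ n /\<^sub>R fact n"
      using norm_blinfun_power_le[where A = z and n = n] by (simp add: divide_simps)
    finally show "norm (s ^ n *\<^sub>R ?P n) \<le> norm z ^ n /\<^sub>R fact n" .
  qed
  then show ?thesis
    unfolding blinfun_exp_scaleR
    by (rule uniform_limit_theorem[rotated])
      (auto intro!: always_eventually continuous_intros)
qed

section \<open>The angle is attained at an eigenvector\<close>

text \<open>
For a positive operator, vectors on which the quadratic form is small are almost in the kernel.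
This is the positivity of the form at \<open>x - T x / M\<close>.
\<close>

lemma norm_power2_le_quadratic_form:
  fixes T :: "'a::real_inner \<Rightarrow>\<^sub>L 'a"
  assumes sym: "\<And>x y. inner (T x) y = inner x (T y)" and pos: "\<And>x. inner (T x) x \<ge> 0"
    and M: "norm T \<le> M" "M > 0"
  shows "(norm (T x))\<^sup>2 \<le> M * inner (T x) x"
proof -
  let ?y = "T x" and ?q = "inner (T x) x"
  have TT: "inner (T ?y) ?y \<le> M * (norm ?y)\<^sup>2"
  proof -
    have "inner (T ?y) ?y \<le> norm (T ?y) * norm ?y" by (rule norm_cauchy_schwarz)
    also have "\<dots> \<le> (M * norm ?y) * norm ?y"
      using norm_blinfun[of T ?y] mult_right_mono[OF M(1), of "norm ?y"]
      by (intro mult_right_mono) auto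
    finally show ?thesis by (simp add: power2_eq_square mult.assoc)
  qed
  have expand: "inner (T (x - a *\<^sub>R ?y)) (x - a *\<^sub>R ?y)
      = ?q - 2 * a * (norm ?y)\<^sup>2 + a\<^sup>2 * inner (T ?y) ?y" for a
    unfolding power2_norm_eq_inner power2_eq_square[of a] using sym[of ?y x]
    by (simp add: blinfun.diff_right blinfun.scaleR_right inner_diff_left inner_diff_right
        inner_commute algebra_simps)
  define a where "a = 1 / M"
  have "0 \<le> ?q - 2 * a * (norm ?y)\<^sup>2 + a\<^sup>2 * inner (T ?y) ?y"
    unfolding expand[symmetric] by (rule pos)
  also have "\<dots> \<le> ?q - 2 * a * (norm ?y)\<^sup>2 + a\<^sup>2 * (M * (norm ?y)\<^sup>2)"
    using TT by (simp add: mult_left_mono)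
  also have "a\<^sup>2 * (M * (norm ?y)\<^sup>2) = a * (norm ?y)\<^sup>2"
    using M(2) by (simp add: a_def power2_eq_square)
  finally have "(norm ?y)\<^sup>2 / M \<le> ?q" by (simp add: a_def)
  then show ?thesis using M(2) by (simp add: pos_divide_le_eq mult.commute)
qed

text \<open>
Let \<open>q = u\<^sup>* v\<close>.  The operator \<open>T = q + q\<^sup>* - 2 c\<close> is positive, and a minimising sequence \<open>X\<close> for
\<open>inner x (q x)\<close> satisfies \<open>T (X n) \<longlonglongrightarrow> 0\<close>.  As \<open>q - 1\<close> is compact and \<open>T\<close> differs from
\<open>2 (1 - c)\<close> by a compact operator, a subsequence converges to a unit vector \<open>x\<close> with \<open>T x = 0\<close>,
that is \<open>(q - e) (q - cnj e) x = 0\<close> with \<open>e = c + i s\<close>, \<open>s = sqrt (1 - c\<^sup>2)\<close>.  Hence either \<open>x\<close> is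
an eigenvector for \<open>cnj e\<close>, or \<open>(q - cnj e) x\<close> is one for \<open>e\<close>.

The conclusion is the eigenvector equation \<open>q \<xi> = c \<xi> + b i \<xi>\<close> in the adjoint form
\<open>q\<^sup>* \<xi> = c \<xi> - b i \<xi>\<close>, tested against \<open>y\<close>; the sign of \<open>b\<close> records which of the two cases
occurred.
\<close>

lemma extremal_angle_eigenvector:
  fixes u v :: "'a::complex_hilbert_space \<Rightarrow>\<^sub>L 'a"
  assumes u: "u \<in> fredholm_unitary_group" and v: "v \<in> fredholm_unitary_group"
    and c: "0 \<le> c" "c < 1"
    and lower: "\<And>x. inner (u x) (v x) \<ge> c * (norm x)\<^sup>2"
    and sharp: "\<And>c'. c < c' \<Longrightarrow> c' \<le> 1 \<Longrightarrow> \<exists>x. inner (u x) (v x) < c' * (norm x)\<^sup>2"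
  obtains \<xi> b where "norm \<xi> = 1" "b\<^sup>2 = 1 - c\<^sup>2"
    "\<And>y. inner (u \<xi>) (v y) = c * inner \<xi> y - b * inner (\<i> *\<^sub>C \<xi>) y"
proof -
  note conclude = that
  have u_unit: "u \<in> unitary_operators" and v_unit: "v \<in> unitary_operators"
    and compact: "v - u \<in> compact_operators"
    using u v compact_operators_diff[of "v - id_blinfun" "u - id_blinfun"]
    by (auto simp: fredholm_unitary_group_def)
  note u_simps = unitary_operatorsD[OF u_unit] and v_simps = unitary_operatorsD[OF v_unit]
  define q where "q = cadjoint u o\<^sub>L v"
  define q' where "q' = cadjoint v o\<^sub>L u"
  have q_lin: "complex_linear q" "complex_linear q'"
    unfolding q_def q'_def by (intro complex_linear_simps u_simps v_simps)+
  have q_inv: "q (q' x) = x" "q' (q x) = x" for x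
    by (simp_all add: q_def q'_def u_simps(2,3) v_simps(2,3))
  have q_adj: "inner (q x) y = inner x (q' y)" for x y
    by (metis blinfun_apply_blinfun_compose q_def q'_def u_simps(2,5) v_simps(4))
  have uv: "inner (u x) (v y) = inner x (q y)" for x y
    by (simp add: q_def u_simps(4))
  have q_norm: "norm (q x) = norm x" "norm (q' x) = norm x" for x
    by (simp_all add: q_def q'_def u_simps(6,7) v_simps(6,7))
  define A where "A = q - id_blinfun"
  have A_compact: "A \<in> compact_operators"
  proof -
    have "A = cadjoint u o\<^sub>L (v - u)"
      by (rule blinfun_eqI)
        (simp add: A_def q_def blinfun.diff_left blinfun.diff_right u_simps(3))
    then show ?thesis by (simp add: compact_operators_compose_left compact u_simps(8))
  qed
  define T where "T = q + q' - (2 * c) *\<^sub>R id_blinfun"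
  have T_apply: "T x = q x + q' x - (2 * c) *\<^sub>R x" for x
    by (simp add: T_def blinfun.bilinear_simps)
  have T_sym: "inner (T x) y = inner x (T y)" for x y
    using q_adj[of x y] q_adj[of y x]
    by (simp add: T_apply inner_add_left inner_add_right inner_diff_left inner_diff_right
        inner_commute)
  have T_form: "inner (T x) x = 2 * (inner x (q x) - c * (norm x)\<^sup>2)" for x
    using q_adj[of x x]
    by (simp add: T_apply inner_add_left inner_add_right inner_diff_left inner_diff_right
        inner_commute power2_norm_eq_inner algebra_simps)
  have T_pos: "inner (T x) x \<ge> 0" for x
    using lower[of x] by (simp add: T_form uv)
  define M where "M = norm T + 1"
  have M: "norm T \<le> M" "M > 0" by (simp_all add: M_def add_nonneg_pos)
  define d where "d n = (1 - c) / real (Suc n)" for n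
  have d: "0 < d n" "d n \<le> 1 - c" for n
    using c by (simp_all add: d_def divide_le_eq mult_le_cancel_left1)
  have "\<exists>x. norm x = 1 \<and> inner x (q x) < c + d n" for n
  proof -
    obtain x where x: "inner x (q x) < (c + d n) * (norm x)\<^sup>2"
      using sharp[of "c + d n"] d[of n] by (auto simp: uv)
    then have "x \<noteq> 0" by auto
    then have n0: "norm x > 0" by simp
    let ?y = "(1 / norm x) *\<^sub>R x"
    have "inner ?y (q ?y) = inner x (q x) / (norm x)\<^sup>2"
      by (simp add: blinfun.scaleR_right power2_eq_square)
    also have "\<dots> < c + d n" using x n0 by (simp add: pos_divide_less_eq)
    finally show ?thesis using n0 by (intro exI[of _ ?y]) simp
  qed
  then obtain X where X: "\<And>n. norm (X n) = 1" "\<And>n. inner (X n) (q (X n)) < c + d n"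
    by metis
  have d_lim: "(\<lambda>n. M * (2 * d n)) \<longlonglongrightarrow> 0"
  proof -
    have "(\<lambda>n. M * (2 * ((1 - c) * (1 / real (Suc n))))) \<longlonglongrightarrow> M * (2 * ((1 - c) * 0))"
      by (intro tendsto_intros LIMSEQ_Suc[OF lim_1_over_n])
    then show ?thesis by (simp add: d_def)
  qed
  have "(\<lambda>n. (norm (T (X n)))\<^sup>2) \<longlonglongrightarrow> 0"
  proof (rule tendsto_sandwich[OF _ _ tendsto_const d_lim])
    have "(norm (T (X n)))\<^sup>2 \<le> M * (2 * d n)" for n
    proof -
      have "(norm (T (X n)))\<^sup>2 \<le> M * inner (T (X n)) (X n)"
        by (rule norm_power2_le_quadratic_form[OF T_sym T_pos M])
      also have "\<dots> \<le> M * (2 * d n)"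
        using X[of n] M(2) by (intro mult_left_mono) (auto simp: T_form)
      finally show ?thesis .
    qed
    then show "\<forall>\<^sub>F n in sequentially. (norm (T (X n)))\<^sup>2 \<le> M * (2 * d n)"
      by (intro always_eventually allI)
  qed simp
  then have "(\<lambda>n. sqrt ((norm (T (X n)))\<^sup>2)) \<longlonglongrightarrow> sqrt 0" by (rule tendsto_real_sqrt)
  then have TX: "(\<lambda>n. T (X n)) \<longlonglongrightarrow> 0"
    by (simp add: tendsto_norm_zero_iff)
  obtain r l where r: "strict_mono (r :: nat \<Rightarrow> nat)" and l: "(\<lambda>n. A (X (r n))) \<longlonglongrightarrow> l"
    using compact_operators_convergent_subsequence[OF A_compact, of X] X(1) by auto
  have TXr: "(\<lambda>n. T (X (r n))) \<longlonglongrightarrow> 0"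
    using LIMSEQ_subseq_LIMSEQ[OF TX r] by (simp add: o_def)
  \<comment> \<open>since \<open>q' - 1 = - q' (q - 1)\<close>, this recovers \<open>x\<close> from \<open>T x\<close> and \<open>A x\<close>, which both converge\<close>
  have solve: "x = (1 / (2 * (1 - c))) *\<^sub>R (T x - A x + q' (A x))" for x
  proof -
    have "T x - A x + q' (A x) = (2 * (1 - c)) *\<^sub>R x"
      by (simp add: T_apply A_def blinfun.diff_left blinfun.diff_right q_inv algebra_simps scaleR_2)
    then show ?thesis using c by simp
  qed
  define x where "x = (1 / (2 * (1 - c))) *\<^sub>R (0 - l + q' l)"
  have "(\<lambda>n. (1 / (2 * (1 - c))) *\<^sub>R (T (X (r n)) - A (X (r n)) + q' (A (X (r n))))) \<longlonglongrightarrow> x"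
    unfolding x_def
    by (intro tendsto_intros TXr l bounded_linear.tendsto[OF blinfun.bounded_linear_right])
  then have Xr: "(\<lambda>n. X (r n)) \<longlonglongrightarrow> x" unfolding solve[symmetric] .
  have "norm x = 1"
    using tendsto_norm[OF Xr] X(1) by (simp add: LIMSEQ_const_iff)
  have "(\<lambda>n. T (X (r n))) \<longlonglongrightarrow> T x"
    by (rule bounded_linear.tendsto[OF blinfun.bounded_linear_right Xr])
  then have "T x = 0" using TXr LIMSEQ_unique by blast
  then have Tx: "q x + q' x = (2 * c) *\<^sub>R x" by (simp add: T_apply)
  define s where "s = sqrt (1 - c\<^sup>2)"
  have s_sq: "s\<^sup>2 = 1 - c\<^sup>2" using c by (simp add: s_def abs_square_le_1)
  have eigen: thesis if \<xi>: "\<xi> \<noteq> 0" and b: "b\<^sup>2 = 1 - c\<^sup>2" and q\<xi>: "q \<xi> = c *\<^sub>R \<xi> + b *\<^sub>R (\<i> *\<^sub>C \<xi>)"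
    for \<xi> b
  proof -
    have ii: "\<i> *\<^sub>C \<i> *\<^sub>C w = - w" for w :: 'a
      using scaleC_of_real[of "-1" w] by (simp add: scaleC_scaleC)
    have lin: "q' (c *\<^sub>R \<xi> + b *\<^sub>R (\<i> *\<^sub>C \<xi>)) = c *\<^sub>R q' \<xi> + b *\<^sub>R (\<i> *\<^sub>C q' \<xi>)"
      using q_lin(2) by (simp add: blinfun.add_right blinfun.scaleR_right complex_linear_def)
    define p where "p = q' \<xi>"
    have p: "\<xi> = c *\<^sub>R p + b *\<^sub>R (\<i> *\<^sub>C p)"
      using q_inv(2)[of \<xi>] lin unfolding q\<xi> p_def by simp
    have "c *\<^sub>R \<xi> - b *\<^sub>R (\<i> *\<^sub>C \<xi>) = (c\<^sup>2 + b\<^sup>2) *\<^sub>R p"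
      unfolding p
      by (simp add: scaleC_add_right scaleC_scaleR ii power2_eq_square algebra_simps)
    then have q'\<xi>: "q' \<xi> = c *\<^sub>R \<xi> - b *\<^sub>R (\<i> *\<^sub>C \<xi>)" by (simp add: b p_def)
    have "inner (u ((1 / norm \<xi>) *\<^sub>R \<xi>)) (v y)
        = c * inner ((1 / norm \<xi>) *\<^sub>R \<xi>) y - b * inner (\<i> *\<^sub>C ((1 / norm \<xi>) *\<^sub>R \<xi>)) y" for y
    proof -
      have "inner \<xi> (q y) = inner (q' \<xi>) y" by (metis q_adj inner_commute)
      then show ?thesis
        by (simp add: uv q'\<xi> scaleC_scaleR inner_diff_left right_diff_distrib)
    qed
    then show ?thesis using conclude[of "(1 / norm \<xi>) *\<^sub>R \<xi>" b] \<xi> b by simp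
  qed
  show ?thesis
  proof (cases "q x = c *\<^sub>R x + (- s) *\<^sub>R (\<i> *\<^sub>C x)")
    case True
    show ?thesis by (rule eigen[OF _ _ True]) (use \<open>norm x = 1\<close> s_sq in auto)
  next
    case False
    define y where "y = q x - (c *\<^sub>R x - s *\<^sub>R (\<i> *\<^sub>C x))"
    have "y \<noteq> 0" using False by (simp add: y_def)
    have ii: "\<i> *\<^sub>C \<i> *\<^sub>C w = - w" for w :: 'a
      using scaleC_of_real[of "-1" w] by (simp add: scaleC_scaleC)
    have "q (q x) = (2 * c) *\<^sub>R q x - x"
      using arg_cong[OF Tx, of q] by (simp add: blinfun.add_right blinfun.scaleR_right q_inv algebra_simps)
    then have "q y = (2 * c) *\<^sub>R q x - x - (c *\<^sub>R q x - s *\<^sub>R (\<i> *\<^sub>C q x))"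
      using q_lin(1) by (simp add: y_def blinfun.diff_right blinfun.scaleR_right complex_linear_def)
    also have "\<dots> = c *\<^sub>R q x + s *\<^sub>R (\<i> *\<^sub>C q x) - (c\<^sup>2 + s\<^sup>2) *\<^sub>R x"
      unfolding s_sq mult_2 scaleR_add_left by (simp add: algebra_simps)
    also have "\<dots> = c *\<^sub>R y + s *\<^sub>R (\<i> *\<^sub>C y)"
      by (simp add: y_def scaleC_diff_right scaleC_add_right scaleC_scaleR ii power2_eq_square algebra_simps)
    finally show ?thesis by (intro eigen[OF \<open>y \<noteq> 0\<close> s_sq])
  qed
qed

section \<open>Convexity\<close>

lemma compact_antihermitianD:
  assumes "z \<in> compact_antihermitian"
  shows "complex_linear z" "inner (z x) y = - inner x (z y)"
proof -
  show lin: "complex_linear z"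
    using assms by (simp add: compact_antihermitian_def compact_operators_def)
  have "is_cadjoint z (- z)"
    using is_cadjoint_cadjoint[OF lin] assms by (simp add: compact_antihermitian_def)
  then show "inner (z x) y = - inner x (z y)"
    by (simp add: is_cadjoint_def blinfun.minus_left inner_minus_right Re_cinner[symmetric])
      (simp add: Re_cinner inner_minus_right)
qed

text \<open>
Below \<open>\<pi>/2\<close> the two bounds for the distance match: \<open>cos g\<close> is the greatest constant \<open>c\<close> with
\<open>c \<parallel>x\<parallel>\<^sup>2 \<le> inner (u x) (v x)\<close> for all \<open>x\<close>.  The constants are capped at \<open>1\<close> because on the zero
space there is no unit vector to cap them.  That \<open>v\<close> lies in the group follows from the distance
being finite.
\<close>

lemma d_inf_eq_angle:
  fixes u v :: "'a::complex_hilbert_space \<Rightarrow>\<^sub>L 'a"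
  assumes u: "u \<in> fredholm_unitary_group" and near: "d_inf u v < ereal (pi / 2)"
  obtains g where "d_inf u v = ereal g" "0 \<le> g" "g < pi / 2" "v \<in> fredholm_unitary_group"
    "\<And>x. cos g * (norm x)\<^sup>2 \<le> inner (u x) (v x)"
    "\<And>c. c \<le> 1 \<Longrightarrow> (\<And>x. c * (norm x)\<^sup>2 \<le> inner (u x) (v x)) \<Longrightarrow> c \<le> cos g"
proof -
  have v: "v \<in> fredholm_unitary_group"
  proof -
    obtain a b \<gamma> where curve: "piecewise_smooth_curve_on a b \<gamma>"
      and group: "\<gamma> ` {a..b} \<subseteq> fredholm_unitary_group" and "\<gamma> b = v"
      using near unfolding d_inf_def Inf_less_iff by blast
    moreover have "a \<le> b" by (rule piecewise_smooth_curve_on_imp_le[OF curve])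
    ultimately show ?thesis by auto
  qed
  have nonneg: "0 \<le> d_inf u v"
    unfolding d_inf_def by (intro Inf_greatest) (auto simp: curve_length_nonneg)
  obtain g where g: "d_inf u v = ereal g"
    using nonneg near by (cases "d_inf u v") auto
  have range: "0 \<le> g" "g < pi / 2" using nonneg near by (simp_all add: g)
  have unit: "norm (u x) = norm x" "norm (v x) = norm x" for x
    using u v unitary_operatorsD(6) by (auto simp: fredholm_unitary_group_def)
  have lower_unit: "cos g \<le> inner (u x) (v x)" if x: "norm x = 1" for x
  proof -
    have r: "\<bar>inner (u x) (v x)\<bar> \<le> 1"
      using Cauchy_Schwarz_ineq2[of "u x" "v x"] by (simp add: unit x)
    have "arccos (inner (u x) (v x)) \<le> g"
      using d_inf_ge_angle[OF x, of u v] by (simp add: g)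
    then have "cos g \<le> cos (arccos (inner (u x) (v x)))"
      using r range by (intro cos_monotone_0_pi_le arccos_lbound) auto
    then show ?thesis using r by (simp add: cos_arccos_abs)
  qed
  have lower: "cos g * (norm x)\<^sup>2 \<le> inner (u x) (v x)" for x
  proof (cases "x = 0")
    case False
    then have n0: "norm x > 0" by simp
    have "cos g \<le> inner (u ((1 / norm x) *\<^sub>R x)) (v ((1 / norm x) *\<^sub>R x))"
      using n0 by (intro lower_unit) simp
    also have "\<dots> = inner (u x) (v x) / (norm x)\<^sup>2"
      by (simp add: blinfun.scaleR_right power2_eq_square)
    finally show ?thesis using n0 by (simp add: pos_le_divide_eq)
  qed simp
  have sharp: "c \<le> cos g" if c: "c \<le> 1" "\<And>x. c * (norm x)\<^sup>2 \<le> inner (u x) (v x)" for c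
  proof (cases "c > 0")
    case True
    have "g \<le> arccos c"
      using d_inf_le_angle[OF u v True c] by (simp add: g)
    then have "cos (arccos c) \<le> cos g"
      using range c(1) True by (intro cos_monotone_0_pi_le arccos_ubound) auto
    then show ?thesis using c True by simp
  next
    case False
    moreover have "cos g > 0" using range by (intro cos_gt_zero_pi) auto
    ultimately show ?thesis by simp
  qed
  show thesis by (rule that[OF g range v lower sharp])
qed

theorem theorem2p8:
  fixes u :: "'a::complex_hilbert_space \<Rightarrow>\<^sub>L 'a"
    and \<beta> :: "real \<Rightarrow> 'a \<Rightarrow>\<^sub>L 'a"
  assumes "u \<in> fredholm_unitary_group"
    and "is_geodesic_on {0..1} \<beta>"
    and "\<forall>s\<in>{0..1}. d_inf u (\<beta> s) < ereal (pi / 2)"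
  shows "convex_on {0..1} (\<lambda>s. real_of_ereal (d_inf u (\<beta> s)))"
proof -
  note u = assms(1)
  obtain w z where w: "w \<in> fredholm_unitary_group" and z: "z \<in> compact_antihermitian"
    and \<beta>: "\<And>s. s \<in> {0..1} \<Longrightarrow> \<beta> s = w o\<^sub>L blinfun_exp (s *\<^sub>R z)"
    using assms(2) unfolding is_geodesic_on_def by blast
  note z_simps = compact_antihermitianD[OF z]
  define g where "g s = real_of_ereal (d_inf u (\<beta> s))" for s
  have g: "0 \<le> g s" "g s < pi / 2" "\<beta> s \<in> fredholm_unitary_group"
    "\<And>x. cos (g s) * (norm x)\<^sup>2 \<le> inner (u x) (\<beta> s x)"
    "\<And>c. c \<le> 1 \<Longrightarrow> (\<And>x. c * (norm x)\<^sup>2 \<le> inner (u x) (\<beta> s x)) \<Longrightarrow> c \<le> cos (g s)"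
    if s: "s \<in> {0..1}" for s
  proof -
    obtain r where "d_inf u (\<beta> s) = ereal r" "0 \<le> r" "r < pi / 2" "\<beta> s \<in> fredholm_unitary_group"
      "\<And>x. cos r * (norm x)\<^sup>2 \<le> inner (u x) (\<beta> s x)"
      "\<And>c. c \<le> 1 \<Longrightarrow> (\<And>x. c * (norm x)\<^sup>2 \<le> inner (u x) (\<beta> s x)) \<Longrightarrow> c \<le> cos r"
      using d_inf_eq_angle[OF u, of "\<beta> s"] assms(3) s by blast
    then show "0 \<le> g s" "g s < pi / 2" "\<beta> s \<in> fredholm_unitary_group"
      "\<And>x. cos (g s) * (norm x)\<^sup>2 \<le> inner (u x) (\<beta> s x)"
      "\<And>c. c \<le> 1 \<Longrightarrow> (\<And>x. c * (norm x)\<^sup>2 \<le> inner (u x) (\<beta> s x)) \<Longrightarrow> c \<le> cos (g s)"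
      by (simp_all add: g_def)
  qed
  have u_norm: "norm (u x) = norm x" for x
    using u unitary_operatorsD(6) by (auto simp: fredholm_unitary_group_def)
  \<comment> \<open>an infimum of functions of \<open>\<beta> s\<close> that are all Lipschitz with constant \<open>1\<close>\<close>
  have cos_lipschitz: "cos (g s) - norm (\<beta> s - \<beta> t) \<le> cos (g t)"
    if s: "s \<in> {0..1}" and t: "t \<in> {0..1}" for s t
  proof (rule g(5)[OF t])
    show "cos (g s) - norm (\<beta> s - \<beta> t) \<le> 1"
      using cos_le_one[of "g s"] norm_ge_zero[of "\<beta> s - \<beta> t"] by linarith
    fix x
    have "inner (u x) ((\<beta> s - \<beta> t) x) \<le> norm (u x) * norm ((\<beta> s - \<beta> t) x)"
      by (rule norm_cauchy_schwarz)
    also have "\<dots> \<le> norm x * (norm (\<beta> s - \<beta> t) * norm x)"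
      unfolding u_norm by (intro mult_left_mono norm_blinfun norm_ge_zero)
    finally have "inner (u x) (\<beta> s x) - inner (u x) (\<beta> t x) \<le> norm (\<beta> s - \<beta> t) * (norm x)\<^sup>2"
      by (simp add: blinfun.diff_left inner_diff_right power2_eq_square mult_ac)
    then show "(cos (g s) - norm (\<beta> s - \<beta> t)) * (norm x)\<^sup>2 \<le> inner (u x) (\<beta> t x)"
      using g(4)[OF s, of x] by (simp add: left_diff_distrib)
  qed
  have \<beta>_cont: "continuous_on {0..1} \<beta>"
  proof -
    have "continuous_on {0..1} (\<lambda>s. w o\<^sub>L blinfun_exp (s *\<^sub>R z))"
      by (intro bounded_bilinear.continuous_on[OF bounded_bilinear_blinfun_compose]
          continuous_on_const continuous_on_blinfun_exp)
    then show ?thesis by (rule continuous_on_eq) (simp add: \<beta>)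
  qed
  have cos_cont: "continuous_on {0..1} (\<lambda>s. cos (g s))"
    unfolding continuous_on_iff
  proof (intro ballI allI impI)
    fix s :: real and e :: real assume s: "s \<in> {0..1}" and e: "e > 0"
    obtain d where d: "d > 0" "\<And>t. t \<in> {0..1} \<Longrightarrow> dist t s < d \<Longrightarrow> dist (\<beta> t) (\<beta> s) < e"
      using \<beta>_cont s e unfolding continuous_on_iff by metis
    have "dist (cos (g t)) (cos (g s)) < e" if t: "t \<in> {0..1}" "dist t s < d" for t
      using d(2)[OF t] cos_lipschitz[OF s t(1)] cos_lipschitz[OF t(1) s]
        norm_minus_commute[of "\<beta> s" "\<beta> t"]
      unfolding dist_norm real_norm_def by linarith
    then show "\<exists>d>0. \<forall>t\<in>{0..1}. dist t s < d \<longrightarrow> dist (cos (g t)) (cos (g s)) < e"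
      using d(1) by blast
  qed
  have g_cont: "continuous_on {0..1} g"
  proof -
    have "continuous_on {0..1} (\<lambda>s. arccos (cos (g s)))"
      by (intro continuous_on_compose2[OF continuous_on_arccos' cos_cont]) auto
    then show ?thesis
    proof (rule continuous_on_eq)
      show "arccos (cos (g s)) = g s" if "s \<in> {0..1}" for s
        using g(1,2)[OF that] by (intro arccos_cos) auto
    qed
  qed
  have "convex_on {0..1} g"
  proof (rule convex_on_if_not_touched_by_concave_parabola[OF g_cont])
    fix s0 p e d :: real
    assume e: "e > 0" and d: "d > 0"
      and touch: "\<And>s. \<bar>s - s0\<bar> < d \<Longrightarrow> s \<in> {0..1} \<and> g s \<le> g s0 + p * (s - s0) - e * (s - s0)\<^sup>2"
    have s0: "s0 \<in> {0..1}" using touch[of s0] d by simp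
    define Q where "Q s = g s0 + p * (s - s0) - e * (s - s0)\<^sup>2" for s
    have g_le_Q: "g s \<le> Q s" and s_in: "s \<in> {0..1}" if "\<bar>s - s0\<bar> < d" for s
      using touch[OF that] by (auto simp: Q_def)
    have Q_der: "(Q has_real_derivative p - 2 * e * (s - s0)) (at s)" for s
      unfolding Q_def by (auto intro!: derivative_eq_intros simp: algebra_simps)
    show False
    proof (cases "g s0 = 0")
      case True
      \<comment> \<open>\<open>g\<close> cannot have a strictly concave majorant touching it at a zero, being nonnegative\<close>
      define h where "h = (if p \<le> 0 then d / 2 else - d / 2)"
      have h: "\<bar>h\<bar> < d" "h \<noteq> 0" "p * h \<le> 0"
        using d by (auto simp: h_def mult_nonneg_nonpos mult_nonpos_nonneg)
      have "0 \<le> Q (s0 + h)"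
        using g(1)[of "s0 + h"] g_le_Q[of "s0 + h"] s_in[of "s0 + h"] h by fastforce
      moreover have "e * h\<^sup>2 > 0" using e h by simp
      ultimately show False using h(3) by (simp add: Q_def True)
    next
      case False
      define \<theta> where "\<theta> = g s0"
      have \<theta>: "0 < \<theta>" "\<theta> < pi / 2" using False g(1,2)[OF s0] by (auto simp: \<theta>_def)
      have sin_pos: "sin \<theta> > 0" using \<theta> by (intro sin_gt_zero) auto
      have cos_range: "0 \<le> cos \<theta>" "cos \<theta> < 1"
        using \<theta> cos_gt_zero_pi[of \<theta>] cos_monotone_0_pi[of 0 \<theta>] by auto
      have sharp: "\<exists>x. inner (u x) (\<beta> s0 x) < c' * (norm x)\<^sup>2" if "cos \<theta> < c'" "c' \<le> 1" for c'
        using g(5)[OF s0, of c'] that by (force simp: \<theta>_def not_le[symmetric])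
      obtain \<xi> b where \<xi>: "norm \<xi> = 1" and b: "b\<^sup>2 = 1 - (cos \<theta>)\<^sup>2"
        and eigen: "\<And>y. inner (u \<xi>) (\<beta> s0 y) = cos \<theta> * inner \<xi> y - b * inner (\<i> *\<^sub>C \<xi>) y"
        using extremal_angle_eigenvector[OF u g(3)[OF s0] cos_range g(4)[OF s0, folded \<theta>_def] sharp]
        by blast
      define a where "a = inner (\<i> *\<^sub>C \<xi>) (z \<xi>)"
      have a: "a\<^sup>2 \<le> (norm (z \<xi>))\<^sup>2"
        using Cauchy_Schwarz_ineq2[of "\<i> *\<^sub>C \<xi>" "z \<xi>"]
        by (simp add: a_def norm_scaleC \<xi> abs_le_square_iff[symmetric])
      have skew0: "inner y (z y) = 0" for y
        using z_simps(2)[of y y] by (simp add: inner_commute)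
      \<comment> \<open>first and second derivative of \<open>inner (u \<xi>) (\<beta> s \<xi>)\<close> at \<open>s0\<close>\<close>
      have first: "inner (u \<xi>) (\<beta> s0 (z \<xi>)) = - (b * a)"
        by (simp add: eigen a_def skew0)
      have second: "inner (u \<xi>) (\<beta> s0 (z (z \<xi>))) = - (cos \<theta> * (norm (z \<xi>))\<^sup>2)"
      proof -
        have "inner \<xi> (z (z \<xi>)) = - (norm (z \<xi>))\<^sup>2"
          using z_simps(2)[of \<xi> "z \<xi>"] by (simp add: power2_norm_eq_inner)
        moreover have "inner (\<i> *\<^sub>C \<xi>) (z (z \<xi>)) = 0"
        proof -
          have "inner (\<i> *\<^sub>C \<xi>) (z (z \<xi>)) = - inner (\<i> *\<^sub>C z \<xi>) (z \<xi>)"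
            using z_simps(2)[of "\<i> *\<^sub>C \<xi>" "z \<xi>"] z_simps(1) by (simp add: complex_linear_def)
          also have "inner (\<i> *\<^sub>C z \<xi>) (z \<xi>) = 0"
            by (simp add: inner_scaleC_left cinner_self)
          finally show ?thesis by simp
        qed
        ultimately show ?thesis by (simp add: eigen)
      qed
      define h where "h y s = inner (u \<xi>) (w (blinfun_exp (s *\<^sub>R z) y))" for y s
      have h_der: "(h y has_real_derivative h (z y) s) (at s)" for y s
      proof -
        have "bounded_linear (\<lambda>A. inner (u \<xi>) (w (blinfun_apply A y)))"
          by (intro bounded_linear_compose[OF bounded_linear_inner_right]
              bounded_linear_compose[OF blinfun.bounded_linear_right] blinfun.bounded_linear_left)
        from DERIV_bounded_linear_blinfun_exp[OF this, of z s]
        show ?thesis by (simp add: h_def[abs_def])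
      qed
      have h_\<beta>: "h y s = inner (u \<xi>) (\<beta> s y)" if "s \<in> {0..1}" for y s
        by (simp add: h_def \<beta>[OF that])
      \<comment> \<open>\<open>D\<close> is nonnegative near \<open>s0\<close> and vanishes there, but its second derivative will be negative\<close>
      define D where "D s = h \<xi> s - cos (Q s)" for s
      define D1 where "D1 s = h (z \<xi>) s + sin (Q s) * (p - 2 * e * (s - s0))" for s
      have D_der: "(D has_real_derivative D1 s) (at s)" for s
        unfolding D_def D1_def by (auto intro!: derivative_eq_intros h_der Q_der)
      have Q0: "Q s0 = \<theta>" by (simp add: Q_def \<theta>_def)
      have D1_der: "(D1 has_real_derivative
          h (z (z \<xi>)) s0 + cos \<theta> * p\<^sup>2 - 2 * e * sin \<theta>) (at s0)"
        unfolding D1_def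
        by (auto intro!: derivative_eq_intros h_der Q_der simp: Q0 power2_eq_square)
      have "\<forall>\<^sub>F s in at s0. Q s < pi"
      proof (rule order_tendstoD(2))
        show "(Q \<longlongrightarrow> Q s0) (at s0)"
          using DERIV_isCont[OF Q_der] by (simp add: isCont_def)
      qed (use Q0 \<theta> in simp)
      then obtain r where r: "r > 0" "\<And>s. s \<noteq> s0 \<Longrightarrow> \<bar>s - s0\<bar> < r \<Longrightarrow> Q s < pi"
        unfolding eventually_at dist_real_def by blast
      have D_min: "D s0 \<le> D s" if s: "\<bar>s - s0\<bar> < min d r" for s
      proof -
        have s': "s \<in> {0..1}" using s s_in by simp
        have "Q s \<le> pi" using r(2)[of s] s Q0 \<theta> by (cases "s = s0") auto
        then have "cos (Q s) \<le> cos (g s)"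
          using g(1)[OF s'] g_le_Q[of s] s by (intro cos_monotone_0_pi_le) auto
        also have "\<dots> \<le> h \<xi> s" using g(4)[OF s', of \<xi>] by (simp add: h_\<beta>[OF s'] \<xi>)
        finally have "0 \<le> D s" by (simp add: D_def)
        moreover have "D s0 = 0"
          using eigen[of \<xi>] by (simp add: D_def h_\<beta>[OF s0] Q0 \<xi> dot_square_norm
              inner_scaleC_left cinner_self)
        ultimately show ?thesis by simp
      qed
      \<comment> \<open>the first order condition forces the slope \<open>p\<close> to be \<open>a\<close> up to sign\<close>
      have "D1 s0 = 0"
        by (rule DERIV_local_min[OF D_der, of "min d r"])
          (use d r(1) D_min in \<open>auto simp: abs_minus_commute\<close>)
      then have "p * sin \<theta> = b * a"
        by (simp add: D1_def h_\<beta>[OF s0] first Q0 mult.commute)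
      then have "p\<^sup>2 * (sin \<theta>)\<^sup>2 = b\<^sup>2 * a\<^sup>2" by (metis power_mult_distrib)
      then have "p\<^sup>2 = a\<^sup>2"
        using sin_pos by (simp add: b sin_squared_eq[symmetric])
      then have "cos \<theta> * p\<^sup>2 \<le> cos \<theta> * (norm (z \<xi>))\<^sup>2"
        using a cos_range by (simp add: mult_left_mono)
      moreover have "e * sin \<theta> > 0" using e sin_pos by simp
      ultimately have neg: "h (z (z \<xi>)) s0 + cos \<theta> * p\<^sup>2 - 2 * e * sin \<theta> < 0"
        by (simp add: h_\<beta>[OF s0] second)
      obtain s where "\<bar>s - s0\<bar> < min d r" "D s < D s0"
        using not_local_min_if_second_derivative_neg[OF D_der D1_der \<open>D1 s0 = 0\<close> neg, of "min d r"]
          d r(1) by auto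
      then show False using D_min[of s] by simp
    qed
  qed
  then show ?thesis by (simp add: g_def[abs_def])
qed

end
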